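(* Let $0<\alpha<1$, $x>0$ and $y\in C^\infty[0,x]$. For integers $n\ge 5$ put $h=x/n$, $y_j=y(jh)$ for $0\le j\le n$, and define $$\delta_0^{(\alpha)}=1-3\zeta(\alpha)+2\zeta(\alpha-1),\qquad \delta_1^{(\alpha)}=\frac{1}{2^\alpha}+4\zeta(\alpha)-4\zeta(\alpha-1),\qquad \delta_2^{(\alpha)}=\frac{1}{3^\alpha}-1-\zeta(\alpha)+2\zeta(\alpha-1),$$ $$\delta_k^{(\alpha)}=\frac{1}{(k+1)^\alpha}-\frac{1}{(k-1)^\alpha}\quad (3\le k\le n-2),$$ $$\delta_{n-1}^{(\alpha)}=-\frac{1}{(n-2)^\alpha}-2S_n[\alpha]+\frac{2n^{1-\alpha}}{1-\alpha},\qquad \delta_n^{(\alpha)}=-\frac{1}{(n-1)^\alpha}+2S_n[\alpha]-\frac{2n^{1-\alpha}}{1-\alpha}.$$ Then, as $n\to\infty$ with $x$ fixed, $$\frac{1}{2\Gamma(1-\alpha)h^\alpha}\sum_{k=0}^{n}\delta_k^{(\alpha)}y_{n-k}=y^{(\alpha)}(x)+O\left(h^{2}\right).$$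
   Context: $\zeta$ is the Riemann zeta function (analytically continued). $S_n[a]=\sum_{k=1}^{n-1}k^{-a}-\zeta(a)$. For $0<\alpha<1$ the Caputo derivative is $y^{(\alpha)}(x)=\frac{1}{\Gamma(1-\alpha)}\int_0^x\frac{y'(t)}{(x-t)^\alpha}\,dt$. The constant implied by $O(\cdot)$ may depend on $y,\alpha,x$ but not on $n$. *)

theory Defs
  imports "HOL-Complex_Analysis.Complex_Analysis" "HOL-Library.Landau_Symbols"
begin

(* The analytic continuation of the Dirichlet series from Re s > 1 to the complex plane without 1.
   It is unique there by the identity theorem; the value of the constant at 1 carries no meaning. *)
definition zeta :: "complex \<Rightarrow> complex" where
  "zeta = (SOME f. f holomorphic_on (- {1}) \<and>
     (\<forall>s. Re s > 1 \<longrightarrow> (\<lambda>k. of_nat (Suc k) powr (- s)) sums f s))"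

(* zeta is real on the real axis, so taking real parts loses nothing. *)
definition zeta_real :: "real \<Rightarrow> real" where
  "zeta_real a = Re (zeta (of_real a))"

(* The quantity S_n[a]; for a > 1 it is minus the tail of the series. *)
definition zeta_tail :: "nat \<Rightarrow> real \<Rightarrow> real" where
  "zeta_tail n a = (\<Sum>k = 1..n - 1. real k powr (- a)) - zeta_real a"

(* One-sided derivatives are taken at the end points of the interval. *)
definition smooth_on_interval :: "real \<Rightarrow> real \<Rightarrow> (real \<Rightarrow> real) \<Rightarrow> bool" where
  "smooth_on_interval a b y \<longleftrightarrow>
     (\<exists>D. (\<forall>t\<in>{a..b}. D 0 t = y t) \<and>
          (\<forall>k. \<forall>t\<in>{a..b}. (D k has_real_derivative D (Suc k) t) (at t within {a..b})))"

(* The integrand is weakly singular at t = x, where division by zero makes it 0. *)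
definition caputo :: "real \<Rightarrow> (real \<Rightarrow> real) \<Rightarrow> real \<Rightarrow> real" where
  "caputo \<alpha> y x =
     1 / Gamma (1 - \<alpha>) *
     integral {0..x} (\<lambda>t. vector_derivative y (at t within {0..x}) / (x - t) powr \<alpha>)"

(* For n >= 5 the cases are disjoint and the final branch is 3 <= k <= n - 2. *)
definition weight :: "real \<Rightarrow> nat \<Rightarrow> nat \<Rightarrow> real" where
  "weight \<alpha> n k =
     (if k = 0 then 1 - 3 * zeta_real \<alpha> + 2 * zeta_real (\<alpha> - 1)
      else if k = 1 then 1 / 2 powr \<alpha> + 4 * zeta_real \<alpha> - 4 * zeta_real (\<alpha> - 1)
      else if k = 2 then 1 / 3 powr \<alpha> - 1 - zeta_real \<alpha> + 2 * zeta_real (\<alpha> - 1)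
      else if k = n - 1 then
        - (1 / (real n - 2) powr \<alpha>) - 2 * zeta_tail n \<alpha> + 2 * real n powr (1 - \<alpha>) / (1 - \<alpha>)
      else if k = n then
        - (1 / (real n - 1) powr \<alpha>) + 2 * zeta_tail n \<alpha> - 2 * real n powr (1 - \<alpha>) / (1 - \<alpha>)
      else 1 / (real k + 1) powr \<alpha> - 1 / (real k - 1) powr \<alpha>)"

definition caputo_approx :: "real \<Rightarrow> (real \<Rightarrow> real) \<Rightarrow> real \<Rightarrow> nat \<Rightarrow> real" where
  "caputo_approx \<alpha> y x n =
     (let h = x / real n
      in 1 / (2 * Gamma (1 - \<alpha>) * h powr \<alpha>) *
         (\<Sum>k = 0..n. weight \<alpha> n k * y (real (n - k) * h)))"

end

theory Submission
  imports Defs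
begin

text \<open>
  The scheme is a corrected trapezoid rule. After the substitution \<open>u = x - t\<close> the Caputo derivative
  is, up to \<open>1 / Gamma (1 - \<alpha>)\<close>, the integral of \<open>u powr (- \<alpha>) * \<phi> u\<close> over \<open>[0, x]\<close> with
  \<open>\<phi> u = y' (x - u)\<close>. Split \<open>\<phi>\<close> into its Taylor polynomial of degree one at 0 and a remainder. The
  remainder makes the integrand regular enough for the trapezoid rule to be of second order
  (\<open>singular_remainder_trapezoid\<close>): its second derivative is \<open>O(u powr (- \<alpha>))\<close>, which is integrable.
  For the pure powers \<open>u powr (- \<alpha>)\<close> and \<open>u powr (1 - \<alpha>)\<close> the trapezoid sum differs from the
  integral by a constant, which is a zeta value, up to an error of second order
  (\<open>zeta_tail_asymptotics\<close>). Hence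
  the integral equals, up to \<open>O(h\<^sup>2)\<close>, \<open>h powr (1 - \<alpha>)\<close> times the trapezoid sum corrected by
  \<open>- zeta \<alpha> * \<phi> 0 - zeta (\<alpha> - 1) * h * \<phi>' 0\<close> (\<open>singular_trapezoid\<close>).

  The weights arise when the derivatives of \<open>y\<close> in this formula are replaced by difference
  quotients (\<open>weight_sum_eq\<close>). Those have errors of order \<open>h\<^sup>2\<close> in the first derivative, and
  the weights \<open>h powr (1 - \<alpha>) * k powr (- \<alpha>)\<close> have a bounded sum, so second order is kept
  (\<open>weight_sum_error\<close>).

  Since zeta is given by a choice, its existence has to be shown first. Taylor expansion of
  \<open>(k + 1) powr (1 - s)\<close> at \<open>k\<close>, summed over \<open>k\<close>, expresses \<open>(s - 1) * zeta s\<close> through the same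
  function at \<open>s + 1, s + 2, \<dots>\<close> and a series that converges further to the left
  (\<open>zeta_series_recursion\<close>), and this gives the continuation one unit strip at a time. Every
  statement about zeta to the left of \<open>Re s = 1\<close> then follows by the identity theorem.
\<close>

section \<open>Taylor remainders of powers and the continuation of zeta\<close>

definition binomial_rem :: "nat \<Rightarrow> complex \<Rightarrow> nat \<Rightarrow> complex" where
  "binomial_rem m w k =
     (of_nat k + 1) powr w - (\<Sum>j<m. (w gchoose j) * of_nat k powr (w - of_nat j))"

text \<open>The Lagrange form of the remainder of the Taylor expansion of \<open>z powr w\<close>, taken along the
  segment from \<open>k\<close> to \<open>k + 1\<close>; on that segment the modulus of a power depends only on the real
  part of the exponent, and since \<open>Re w \<le> m\<close> the derivative is largest at \<open>k\<close>.\<close>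
lemma norm_binomial_rem_le:
  assumes "0 < k" "0 < m" "Re w \<le> real m"
  shows "norm (binomial_rem m w k) \<le> real m * norm (w gchoose m) * real k powr (Re w - real m)"
proof -
  obtain n where m: "m = Suc n" using assms(2) by (cases m) auto
  define S where "S = closed_segment (of_nat k :: complex) (of_nat k + 1)"
  define f where "f = (\<lambda>i x. fact i * (w gchoose i) * x powr (w - of_nat i) :: complex)"
  have S: "\<exists>t\<ge>real k. x = of_real t" if x: "x \<in> S" for x
  proof -
    obtain u where "0 \<le> u" "x = (1 - u) *\<^sub>R of_nat k + u *\<^sub>R (of_nat k + 1)"
      using x unfolding S_def in_segment by blast
    then show ?thesis
      by (intro exI[of _ "real k + u"]) (auto simp: complex_eq_iff algebra_simps)
  qed
  have deriv: "(f i has_field_derivative f (Suc i) x) (at x within S)" if x: "x \<in> S" for i x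
  proof -
    obtain t where t: "t \<ge> real k" "x = of_real t" using S[OF x] by blast
    have nz: "x \<notin> \<real>\<^sub>\<le>\<^sub>0" using t assms(1) by simp
    have "fact (Suc i) * (w gchoose Suc i) = (w - of_nat i) * (fact i * (w gchoose i))"
      unfolding gbinomial_mult_fact by (simp only: prod.atLeast0_lessThan_Suc mult_ac)
    moreover have "w - of_nat (Suc i) = w - of_nat i - 1" by simp
    ultimately have eq: "f (Suc i) x
        = fact i * (w gchoose i) * ((w - of_nat i) * x powr (w - of_nat i - 1))"
      unfolding f_def by (simp only: mult_ac)
    show ?thesis
      unfolding eq unfolding f_def
      by (rule DERIV_cmult, rule has_field_derivative_at_within, rule has_field_derivative_powr[OF nz])
  qed
  have bound: "norm (f (Suc n) x) \<le> fact m * norm (w gchoose m) * real k powr (Re w - real m)"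
    if x: "x \<in> S" for x
  proof -
    obtain t where t: "t \<ge> real k" "x = of_real t" using S[OF x] by blast
    have "norm (x powr (w - of_nat m)) = t powr (Re w - real m)"
      using t assms(1) by (simp add: norm_powr_real_powr)
    also have "\<dots> \<le> real k powr (Re w - real m)"
      using t assms by (intro powr_mono2') auto
    finally show ?thesis
      unfolding f_def m[symmetric] norm_mult by (simp add: mult_left_mono)
  qed
  have "norm (f 0 (of_nat k + 1) - (\<Sum>i\<le>n. f i (of_nat k) * (of_nat k + 1 - of_nat k) ^ i / fact i))
      \<le> fact m * norm (w gchoose m) * real k powr (Re w - real m)
          * norm (of_nat k + 1 - of_nat k :: complex) ^ Suc n / fact n"
    by (rule field_Taylor[of S n f, OF _ deriv bound]) (simp_all add: S_def)
  moreover have "f 0 (of_nat k + 1) - (\<Sum>i\<le>n. f i (of_nat k) * (of_nat k + 1 - of_nat k) ^ i / fact i)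
      = binomial_rem m w k"
    by (simp add: f_def binomial_rem_def m lessThan_Suc_atMost)
  moreover have "fact m / fact n = real m" by (simp add: m)
  ultimately show ?thesis
    by (simp add: field_simps)
qed

lemma summable_Suc_powr:
  fixes r :: real
  assumes "r < -1"
  shows "summable (\<lambda>k. real (Suc k) powr r)"
  using assms summable_real_powr_iff[of r] summable_Suc_iff[of "\<lambda>k. real k powr r"] by simp

lemma binomial_rem_summable:
  assumes "0 < m" "Re w < real m - 1"
  shows "summable (\<lambda>k. binomial_rem m w (Suc k))"
proof (rule summable_comparison_test')
  show "summable (\<lambda>k. real m * norm (w gchoose m) * real (Suc k) powr (Re w - real m))"
    using assms by (intro summable_mult summable_Suc_powr) auto
  show "norm (binomial_rem m w (Suc k))
      \<le> real m * norm (w gchoose m) * real (Suc k) powr (Re w - real m)" for k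
    using assms by (intro norm_binomial_rem_le) auto
qed

lemma holomorphic_on_gbinomial [holomorphic_intros]:
  assumes "f holomorphic_on A"
  shows "(\<lambda>z. f z gchoose k) holomorphic_on A"
  unfolding gbinomial_prod_rev by (intro holomorphic_intros assms) auto

lemma holomorphic_binomial_rem: "0 < k \<Longrightarrow> (\<lambda>w. binomial_rem m w k) holomorphic_on A"
  unfolding binomial_rem_def by (intro holomorphic_intros) (auto simp: add_eq_0_iff)

lemma open_Re_lt: "open {w. Re w < c}"
  by (intro open_Collect_less continuous_intros)

lemma open_Re_gt: "open {w. Re w > c}"
  by (intro open_Collect_less continuous_intros)

text \<open>Near a given point the real part of \<open>w\<close> stays below some \<open>r < m - 1\<close>, so the bound on the
  remainders gives a convergent majorant \<open>k powr (r - m)\<close>. Each additional Taylor term moves the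
  boundary of holomorphy by one; this is what drives the continuation of zeta.\<close>
lemma holomorphic_binomial_rem_series:
  assumes "0 < m"
  shows "(\<lambda>w. \<Sum>k. binomial_rem m w (Suc k)) holomorphic_on {w. Re w < real m - 1}"
proof (rule holomorphic_uniform_sequence[where f = "\<lambda>n w. \<Sum>k<n. binomial_rem m w (Suc k)"])
  show "open {w. Re w < real m - 1}" by (rule open_Re_lt)
  show "(\<lambda>w. \<Sum>k<n. binomial_rem m w (Suc k)) holomorphic_on {w. Re w < real m - 1}" for n
    by (intro holomorphic_intros holomorphic_binomial_rem) auto
next
  fix w assume "w \<in> {w. Re w < real m - 1}"
  then obtain d where d: "0 < d" "cball w d \<subseteq> {w. Re w < real m - 1}"
    using open_Re_lt open_contains_cball by blast
  define r where "r = Re w + d"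
  have "w + of_real d \<in> cball w d" using d(1) by (simp add: dist_norm)
  with d(2) have r: "r < real m - 1" by (auto simp: r_def)
  have re: "Re v \<le> r" if "v \<in> cball w d" for v
  proof -
    have "Re v - Re w \<le> norm (v - w)" using complex_Re_le_cmod[of "v - w"] by simp
    also have "\<dots> \<le> d" using that by (simp add: dist_norm norm_minus_commute)
    finally show ?thesis by (simp add: r_def)
  qed
  have "compact ((\<lambda>v. v gchoose m) ` cball w d)"
    by (intro compact_continuous_image holomorphic_on_imp_continuous_on holomorphic_intros) auto
  then obtain B where B: "norm (v gchoose m) \<le> B" if "v \<in> cball w d" for v
    unfolding compact_eq_bounded_closed bounded_iff by blast
  have B0: "0 \<le> B" using order_trans[OF norm_ge_zero B[of w]] d(1) by simp
  have "uniform_limit (cball w d) (\<lambda>n v. \<Sum>k<n. binomial_rem m v (Suc k))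
      (\<lambda>v. \<Sum>k. binomial_rem m v (Suc k)) sequentially"
  proof (rule Weierstrass_m_test)
    show "summable (\<lambda>k. real m * B * real (Suc k) powr (r - real m))"
      using r by (intro summable_mult summable_Suc_powr) auto
    fix k v assume v: "v \<in> cball w d"
    have "norm (binomial_rem m v (Suc k))
        \<le> real m * norm (v gchoose m) * real (Suc k) powr (Re v - real m)"
      using v d assms by (intro norm_binomial_rem_le) auto
    also have "\<dots> \<le> real m * B * real (Suc k) powr (r - real m)"
      using v B B0 re[OF v] by (intro mult_mono powr_mono) auto
    finally show "norm (binomial_rem m v (Suc k)) \<le> real m * B * real (Suc k) powr (r - real m)" .
  qed
  with d show "\<exists>d>0. cball w d \<subseteq> {w. Re w < real m - 1} \<and>
      uniform_limit (cball w d) (\<lambda>n v. \<Sum>k<n. binomial_rem m v (Suc k))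
        (\<lambda>v. \<Sum>k. binomial_rem m v (Suc k)) sequentially" by blast
qed

lemma holomorphic_binomial_rem_series_reflect:
  assumes "0 < m"
  shows "(\<lambda>s. \<Sum>k. binomial_rem m (of_real c - s) (Suc k)) holomorphic_on {s. Re s > c + 1 - real m}"
proof -
  have "(\<lambda>w. \<Sum>k. binomial_rem m w (Suc k)) \<circ> (\<lambda>s. of_real c - s) holomorphic_on {s. Re s > c + 1 - real m}"
    by (rule holomorphic_on_compose_gen[OF _ holomorphic_binomial_rem_series[OF assms]])
       (auto intro!: holomorphic_intros)
  then show ?thesis by (simp add: o_def)
qed

definition zeta_series :: "complex \<Rightarrow> complex" where
  "zeta_series s = (\<Sum>k. of_nat (Suc k) powr (- s))"

lemma zeta_series_sums:
  assumes "Re s > 1"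
  shows "(\<lambda>k. of_nat (Suc k) powr (- s)) sums zeta_series s"
  unfolding zeta_series_def
proof (rule summable_sums, rule summable_comparison_test')
  show "summable (\<lambda>k. real (Suc k) powr (- Re s))"
    using assms by (intro summable_Suc_powr) auto
  show "norm (of_nat (Suc k) powr (- s)) \<le> real (Suc k) powr (- Re s)" for k
    by (subst norm_powr_real_powr) (auto simp del: of_nat_Suc)
qed

lemma Suc_powr_tendsto_0:
  fixes s :: complex
  assumes "Re s < 0"
  shows "(\<lambda>k. of_nat (Suc k) powr s) \<longlonglongrightarrow> 0"
proof -
  have "(\<lambda>k. real (Suc k) powr Re s) \<longlonglongrightarrow> 0"
    by (rule tendsto_neg_powr[OF assms]) (rule filterlim_compose[OF filterlim_real_sequentially filterlim_Suc])
  then show ?thesis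
    by (rule Lim_null_comparison[rotated])
       (auto intro!: always_eventually simp: norm_powr_real_powr simp del: of_nat_Suc)
qed

text \<open>Summing the Taylor expansion of \<open>(k + 1) powr (1 - s) - k powr (1 - s)\<close> over all \<open>k \<ge> 1\<close>
  telescopes to \<open>-1\<close> on one side and gives values of the series at \<open>s, s + 1, \<dots>\<close> on the other.
  The factor \<open>s + j - 2\<close> comes from absorbing the last factor of the binomial coefficient; with it
  the identity speaks only of the functions \<open>(s - 1) * zeta s\<close> at shifted arguments, which have no
  pole, so nothing has to be cancelled when it is used to the left of the line \<open>Re s = 1\<close>.\<close>
lemma zeta_series_recursion:
  assumes s: "Re s > 1" and m: "2 \<le> m"
  shows "(s - 1) * zeta_series s = 1 + (\<Sum>k. binomial_rem m (1 - s) (Suc k))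
    - (\<Sum>j=2..<m. ((1 - s) gchoose (j - 1)) / of_nat j
          * ((s + of_nat j - 2) * zeta_series (s + of_nat j - 1)))"
proof -
  define p where "p = (\<lambda>k. of_nat (Suc k) powr (1 - s))"
  have tele: "(\<lambda>k. p (Suc k) - p k) sums (0 - p 0)"
    unfolding p_def using s by (intro telescope_sums Suc_powr_tendsto_0) auto
  have shifted: "(\<lambda>k. of_nat (Suc k) powr (1 - s - of_nat j)) sums zeta_series (s + of_nat j - 1)"
    if "j \<in> {1..<m}" for j
  proof -
    have "1 - s - of_nat j = - (s + of_nat j - 1)" by simp
    then show ?thesis
      using zeta_series_sums[of "s + of_nat j - 1"] s that by (simp only:) auto
  qed
  have "(\<lambda>k. (p (Suc k) - p k)
            - (\<Sum>j\<in>{1..<m}. ((1 - s) gchoose j) * of_nat (Suc k) powr (1 - s - of_nat j)))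
      sums (0 - p 0 - (\<Sum>j\<in>{1..<m}. ((1 - s) gchoose j) * zeta_series (s + of_nat j - 1)))"
    by (intro sums_diff tele sums_sum sums_mult shifted)
  moreover have "binomial_rem m (1 - s) (Suc k) = (p (Suc k) - p k)
       - (\<Sum>j\<in>{1..<m}. ((1 - s) gchoose j) * of_nat (Suc k) powr (1 - s - of_nat j))" for k
  proof -
    have "{..<m} = insert 0 {1..<m}" using m by auto
    then show ?thesis by (simp add: binomial_rem_def p_def algebra_simps)
  qed
  ultimately have "(\<Sum>k. binomial_rem m (1 - s) (Suc k))
      = - 1 - (\<Sum>j\<in>{1..<m}. ((1 - s) gchoose j) * zeta_series (s + of_nat j - 1))"
    by (simp add: sums_iff p_def)
  also have "{1..<m} = insert 1 {2..<m}" using m by auto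
  also have "(\<Sum>j\<in>insert 1 {2..<m}. ((1 - s) gchoose j) * zeta_series (s + of_nat j - 1))
      = (1 - s) * zeta_series s + (\<Sum>j=2..<m. ((1 - s) gchoose j) * zeta_series (s + of_nat j - 1))"
    by simp
  also have "(\<Sum>j=2..<m. ((1 - s) gchoose j) * zeta_series (s + of_nat j - 1))
      = - (\<Sum>j=2..<m. ((1 - s) gchoose (j - 1)) / of_nat j
          * ((s + of_nat j - 2) * zeta_series (s + of_nat j - 1)))"
    unfolding sum_negf[symmetric]
  proof (rule sum.cong[OF refl])
    fix j assume j: "j \<in> {2..<m}"
    then obtain i where i: "j = Suc i" by (cases j) auto
    have "of_nat j * ((1 - s) gchoose j) = (1 - s - of_nat i) * ((1 - s) gchoose i)"
      unfolding i using gbinomial_absorb_comp[of "1 - s" i] gbinomial_absorption[of i "1 - s"]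
      by (simp add: gbinomial_absorption')
    moreover have "(of_nat j :: complex) \<noteq> 0" using j by auto
    ultimately have "((1 - s) gchoose j) = - ((1 - s) gchoose i) / of_nat j * (s + of_nat j - 2)"
      unfolding i by (simp add: field_simps)
    then show "((1 - s) gchoose j) * zeta_series (s + of_nat j - 1)
      = - (((1 - s) gchoose (j - 1)) / of_nat j * ((s + of_nat j - 2) * zeta_series (s + of_nat j - 1)))"
      by (simp add: i)
  qed
  finally show ?thesis by (simp add: algebra_simps)
qed

text \<open>The right-hand side of \<open>zeta_series_recursion\<close> uses \<open>\<Phi>\<close> only at points lying at
  least one unit further right, so a function on one half plane yields one on the next. For
  \<open>m = 2\<close> the sum over \<open>j\<close> is empty and the recursion is an explicit formula, which starts the
  induction.\<close>
lemma zeta_continuation_halfplane: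
  "\<exists>\<Phi>. \<Phi> holomorphic_on {s. Re s > - real N} \<and> (\<forall>s. Re s > 1 \<longrightarrow> \<Phi> s = (s - 1) * zeta_series s)"
proof (induction N)
  case 0
  have "(\<lambda>s. 1 + (\<Sum>k. binomial_rem 2 (1 - s) (Suc k))) holomorphic_on {s. Re s > 0}"
    using holomorphic_binomial_rem_series_reflect[of 2 1] by (intro holomorphic_intros) simp
  moreover have "1 + (\<Sum>k. binomial_rem 2 (1 - s) (Suc k)) = (s - 1) * zeta_series s" if "Re s > 1" for s
    using zeta_series_recursion[OF that, of 2] by simp
  ultimately show ?case by auto
next
  case (Suc N)
  then obtain \<Phi> where hol: "\<Phi> holomorphic_on {s. Re s > - real N}"
    and eq: "\<And>s. Re s > 1 \<Longrightarrow> \<Phi> s = (s - 1) * zeta_series s" by blast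
  define m where "m = N + 3"
  define \<Psi> where "\<Psi> = (\<lambda>s. 1 + (\<Sum>k. binomial_rem m (1 - s) (Suc k))
    - (\<Sum>j=2..<m. ((1 - s) gchoose (j - 1)) / of_nat j * \<Phi> (s + of_nat j - 1)))"
  have rem: "(\<lambda>s. \<Sum>k. binomial_rem m (1 - s) (Suc k)) holomorphic_on {s. Re s > - real (Suc N)}"
    using holomorphic_binomial_rem_series_reflect[of m 1] by (simp add: m_def algebra_simps)
  have shift: "(\<lambda>s. \<Phi> (s + of_nat j - 1)) holomorphic_on {s. Re s > - real (Suc N)}"
    if "j \<in> {2..<m}" for j
  proof -
    have "\<Phi> \<circ> (\<lambda>s. s + of_nat j - 1) holomorphic_on {s. Re s > - real (Suc N)}"
      by (rule holomorphic_on_compose_gen[OF _ hol]) (use that in \<open>auto intro!: holomorphic_intros\<close>)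
    then show ?thesis by (simp add: o_def)
  qed
  have "\<Psi> holomorphic_on {s. Re s > - real (Suc N)}"
    unfolding \<Psi>_def by (intro holomorphic_intros rem shift) auto
  moreover have "\<Psi> s = (s - 1) * zeta_series s" if s: "Re s > 1" for s
  proof -
    have "\<Phi> (s + of_nat j - 1) = (s + of_nat j - 2) * zeta_series (s + of_nat j - 1)"
      if "j \<in> {2..<m}" for j
      using eq[of "s + of_nat j - 1"] s that by (simp add: algebra_simps)
    then show ?thesis
      unfolding \<Psi>_def using zeta_series_recursion[OF s, of m] by (simp add: m_def)
  qed
  ultimately show ?case by blast
qed

text \<open>The functions on the half planes agree where they are both defined, by the identity theorem, so
  at each point any half plane that contains it may be used.\<close>
lemma zeta_exists:
  "\<exists>f. f holomorphic_on (- {1}) \<and>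
     (\<forall>s. Re s > 1 \<longrightarrow> (\<lambda>k. of_nat (Suc k) powr (- s)) sums f s)"
proof -
  define H where "H = (\<lambda>N :: nat. {s :: complex. Re s > - real N})"
  obtain \<Phi> where hol: "\<And>N. \<Phi> N holomorphic_on H N"
    and eq: "\<And>N s. Re s > 1 \<Longrightarrow> \<Phi> N s = (s - 1) * zeta_series s"
    using zeta_continuation_halfplane unfolding H_def by metis
  have openH: "open (H N)" for N unfolding H_def by (rule open_Re_gt)
  have agree: "\<Phi> M s = \<Phi> N s" if "M \<le> N" "s \<in> H M" for M N s
  proof (rule analytic_continuation_open[of "{s. Re s > 1}" "H M" "\<Phi> M" "\<Phi> N"])
    show "connected (H M)"
      unfolding H_def by (intro convex_connected convex_halfspace_Re_gt)
    show "{s. Re s > 1} \<noteq> {}" by (auto intro!: exI[of _ 2])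
    show "\<Phi> N holomorphic_on H M"
      using hol[of N] by (rule holomorphic_on_subset) (use that(1) in \<open>auto simp: H_def\<close>)
  qed (use hol eq that openH in \<open>auto simp: open_Re_gt H_def\<close>)
  define F where "F = (\<lambda>s. \<Phi> (nat \<lceil>\<bar>Re s\<bar>\<rceil> + 1) s)"
  have F: "F s = \<Phi> N s" if "s \<in> H N" for N s
  proof -
    have "s \<in> H (nat \<lceil>\<bar>Re s\<bar>\<rceil> + 1)" unfolding H_def by simp linarith
    then show ?thesis
      unfolding F_def using agree that by (metis nle_le)
  qed
  have "F holomorphic_on UNIV"
  proof -
    have "F holomorphic_on (\<Union>N. H N)"
    proof (rule holomorphic_on_UN_open)
      show "F holomorphic_on H N" for N
        using hol[of N] by (rule holomorphic_transform) (simp add: F)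
    qed (rule openH)
    moreover have "(\<Union>N. H N) = UNIV"
    proof -
      have "\<exists>N. s \<in> H N" for s
        using reals_Archimedean2[of "- Re s"] by (auto simp: H_def minus_less_iff)
      then show ?thesis by auto
    qed
    ultimately show ?thesis by simp
  qed
  then have "(\<lambda>s. F s / (s - 1)) holomorphic_on (- {1})"
    by (intro holomorphic_intros) (auto intro: holomorphic_on_subset)
  moreover have "(\<lambda>k. of_nat (Suc k) powr (- s)) sums (F s / (s - 1))" if "Re s > 1" for s
  proof -
    have "F s = (s - 1) * zeta_series s"
      using F[of s 0] eq that by (simp add: H_def)
    moreover have "s \<noteq> 1" using that by auto
    ultimately show ?thesis using zeta_series_sums[OF that] by simp
  qed
  ultimately show ?thesis by blast
qed

lemma
  shows zeta_holomorphic: "zeta holomorphic_on (- {1})"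
    and zeta_eq_series: "Re s > 1 \<Longrightarrow> zeta s = zeta_series s"
proof -
  have *: "zeta holomorphic_on (- {1}) \<and>
     (\<forall>s. Re s > 1 \<longrightarrow> (\<lambda>k. of_nat (Suc k) powr (- s)) sums zeta s)"
    unfolding zeta_def by (rule someI_ex[OF zeta_exists])
  show "zeta holomorphic_on (- {1})" using * by blast
  show "Re s > 1 \<Longrightarrow> zeta s = zeta_series s"
    using * zeta_series_sums sums_unique2 by blast
qed

section \<open>Zeta values as constants in the trapezoid rule for powers\<close>

text \<open>Up to the factor \<open>s - 1\<close>, and an additive constant, this is the trapezoid sum of \<open>u powr (- s)\<close>
  on \<open>[1, n]\<close> minus the integral. The factor keeps it free of a pole at 1.\<close>
definition trapezoid_sum :: "complex \<Rightarrow> nat \<Rightarrow> complex" where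
  "trapezoid_sum s n =
     (s - 1) * ((\<Sum>k = 1..n - 1. of_nat k powr (- s)) + of_nat n powr (- s) / 2)
       + of_nat n powr (1 - s)"

text \<open>Writing the trapezoid error on \<open>[n, n + 1]\<close> through Taylor remainders makes the bounds and
  the holomorphy already proved for those available; the Taylor terms of order up to two cancel,
  which is the exactness of the trapezoid rule for linear functions.\<close>
lemma trapezoid_sum_Suc_diff:
  assumes "1 \<le> n"
  shows "trapezoid_sum s (Suc n) - trapezoid_sum s n
     = binomial_rem 3 (1 - s) n - (1 - s) / 2 * binomial_rem 2 (- s) n"
proof -
  have sum: "(\<Sum>k = 1..n. of_nat k powr (- s)) = (\<Sum>k = 1..n - 1. of_nat k powr (- s)) + of_nat n powr (- s)"
    using assms by (cases n) auto
  have g2: "(w gchoose 2) = w * (w - 1) / 2" for w :: complex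
    by (simp add: gbinomial_prod_rev numeral_2_eq_2)
  have e: "1 - s - 1 = - s" "1 - s - 2 = - s - 1" by simp_all
  have r3: "binomial_rem 3 (1 - s) n = (of_nat n + 1) powr (1 - s)
      - (of_nat n powr (1 - s) + (1 - s) * of_nat n powr (- s)
          + (1 - s) * (- s) / 2 * of_nat n powr (- s - 1))"
  proof -
    have "{..<3 :: nat} = {0, 1, 2}" by auto
    then show ?thesis unfolding binomial_rem_def by (simp add: g2 e)
  qed
  have r2: "binomial_rem 2 (- s) n = (of_nat n + 1) powr (- s)
      - (of_nat n powr (- s) + (- s) * of_nat n powr (- s - 1))"
    unfolding binomial_rem_def by (simp add: numeral_2_eq_2)
  have S: "of_nat (Suc n) = (of_nat n + 1 :: complex)" by simp
  show ?thesis
    unfolding r3 r2 trapezoid_sum_def diff_Suc_1 sum S by (simp add: field_simps)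
qed

text \<open>The limit exists and is holomorphic for \<open>Re s > -1\<close>; for \<open>Re s > 1\<close> the boundary terms vanish
  and it is the series. The identity theorem carries the equality to the left.\<close>
lemma trapezoid_sum_tendsto:
  assumes s: "Re s > -1" "s \<noteq> 1"
  shows "trapezoid_sum s \<longlonglongrightarrow> (s - 1) * zeta s"
proof -
  define L where "L = (\<lambda>s. (\<Sum>k. binomial_rem 3 (of_real 1 - s) (Suc k))
     - (1 - s) / 2 * (\<Sum>k. binomial_rem 2 (of_real 0 - s) (Suc k)) + trapezoid_sum s 1)"
  have L: "(\<lambda>n. trapezoid_sum s (Suc n)) \<longlonglongrightarrow> L s" if s: "Re s > -1" for s
  proof -
    have "(\<lambda>k. binomial_rem 3 (1 - s) (Suc k) - (1 - s) / 2 * binomial_rem 2 (0 - s) (Suc k))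
      sums (L s - trapezoid_sum s 1)"
      unfolding L_def of_real_1 of_real_0 add_diff_cancel_right'
      using s by (intro sums_diff sums_mult summable_sums binomial_rem_summable) auto
    then have "(\<lambda>n. \<Sum>k<n. trapezoid_sum s (Suc (Suc k)) - trapezoid_sum s (Suc k))
        \<longlonglongrightarrow> L s - trapezoid_sum s 1"
      unfolding sums_def by (simp add: trapezoid_sum_Suc_diff)
    then have "(\<lambda>n. trapezoid_sum s (Suc n) - trapezoid_sum s 1) \<longlonglongrightarrow> L s - trapezoid_sum s 1"
      using sum_lessThan_telescope[of "\<lambda>k. trapezoid_sum s (Suc k)"] by simp
    from tendsto_add[OF this tendsto_const[of "trapezoid_sum s 1"]] show ?thesis by simp
  qed
  have "L holomorphic_on {s. Re s > -1}"
    unfolding L_def trapezoid_sum_def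
    using holomorphic_binomial_rem_series_reflect[of 3 1] holomorphic_binomial_rem_series_reflect[of 2 0]
    by (intro holomorphic_intros) auto
  then have hol: "L holomorphic_on ({s. Re s > -1} - {1})"
    by (rule holomorphic_on_subset) auto
  have eq: "L s = (s - 1) * zeta s" if s: "Re s > 1" for s
  proof (rule LIMSEQ_unique)
    show "(\<lambda>n. trapezoid_sum s (Suc n)) \<longlonglongrightarrow> L s" using s by (intro L) auto
    have "(\<lambda>n. (s - 1) * ((\<Sum>k<n. of_nat (Suc k) powr (- s)) + of_nat (Suc n) powr (- s) / 2)
        + of_nat (Suc n) powr (1 - s)) \<longlonglongrightarrow> (s - 1) * (zeta s + 0 / 2) + 0"
      using zeta_series_sums[OF s] s unfolding zeta_eq_series[OF s] sums_def
      by (intro tendsto_intros Suc_powr_tendsto_0) auto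
    moreover have "(\<Sum>k<n. of_nat (Suc k) powr (- s)) = (\<Sum>k=1..n. of_nat k powr (- s))" for n
      by (simp only: sum.atLeast1_atMost_eq One_nat_def)
    ultimately show "(\<lambda>n. trapezoid_sum s (Suc n)) \<longlonglongrightarrow> (s - 1) * zeta s"
      unfolding trapezoid_sum_def by simp
  qed
  have "L s = (s - 1) * zeta s"
  proof (rule analytic_continuation_open[of "{s. Re s > 1}" "{s. Re s > -1} - {1}" L "\<lambda>s. (s - 1) * zeta s"])
    show "connected ({s. Re s > -1} - {1 :: complex})"
      by (intro connected_open_delete open_Re_gt convex_connected convex_halfspace_Re_gt) simp
    show "{s. Re s > 1} \<noteq> {}" by (auto intro!: exI[of _ 2])
    show "(\<lambda>s. (s - 1) * zeta s) holomorphic_on {s. Re s > -1} - {1}"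
      by (intro holomorphic_intros holomorphic_on_subset[OF zeta_holomorphic]) auto
  qed (use hol eq s in \<open>auto simp: open_Re_gt\<close>)
  then show ?thesis using L[OF s(1)] filterlim_sequentially_Suc[of "trapezoid_sum s"] by simp
qed

text \<open>A telescoping majorant in place of an estimate for tails of convergent series.\<close>
lemma powr_le_telescope:
  fixes p :: real
  assumes "0 < p" "1 \<le> n"
  shows "real n powr (- p - 1) \<le> 2 powr (p + 1) / p * (real n powr (- p) - real (Suc n) powr (- p))"
proof -
  have "\<exists>\<xi>>real n. \<xi> < real (Suc n) \<and>
     real (Suc n) powr (- p) - real n powr (- p) = (real (Suc n) - real n) * (- p * \<xi> powr (- p - 1))"
    using assms by (intro MVT2) (auto intro!: derivative_eq_intros)
  then obtain \<xi> where \<xi>: "\<xi> > real n" "\<xi> < real (Suc n)"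
    "real n powr (- p) - real (Suc n) powr (- p) = p * \<xi> powr (- p - 1)" by auto
  have "(2 * real n) powr (- p - 1) \<le> \<xi> powr (- p - 1)"
    using assms \<xi> by (intro powr_mono2') auto
  then have "real n powr (- p - 1) / 2 powr (p + 1) \<le> \<xi> powr (- p - 1)"
    using powr_minus_divide[of 2 "p + 1"] by (simp add: powr_mult)
  then show ?thesis
    unfolding \<xi>(3) using assms by (simp add: field_simps)
qed

lemma norm_limit_diff_le:
  fixes a :: "nat \<Rightarrow> 'a :: real_normed_vector" and g :: "nat \<Rightarrow> real"
  assumes lim: "a \<longlonglongrightarrow> L" and g: "\<And>k. 0 \<le> g k"
    and step: "\<And>k. n \<le> k \<Longrightarrow> norm (a (Suc k) - a k) \<le> g k - g (Suc k)"
  shows "norm (a n - L) \<le> g n"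
proof -
  have le: "norm (a n - a m) \<le> g n - g m" if "n \<le> m" for m
    using that
  proof (induction m rule: dec_induct)
    case (step m)
    then show ?case
      using norm_triangle_ineq[of "a n - a m" "a m - a (Suc m)"] assms(3)[of m]
      by (simp add: norm_minus_commute)
  qed simp
  have "(\<lambda>m. norm (a n - a m)) \<longlonglongrightarrow> norm (a n - L)"
    by (intro tendsto_intros lim)
  moreover have "norm (a n - a m) \<le> g n" if "n \<le> m" for m
    using le[OF that] g[of m] by simp
  ultimately show ?thesis
    by (intro LIMSEQ_le_const2[of "\<lambda>m. norm (a n - a m)"]) blast+
qed

text \<open>The steps of \<open>trapezoid_sum\<close> are of order \<open>n powr (- Re s - 2)\<close>, so what remains after \<open>n\<close>
  steps is of order \<open>n powr (- Re s - 1)\<close>.\<close>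
lemma trapezoid_sum_error:
  assumes s: "Re s > -1" "s \<noteq> 1"
  obtains C where "\<And>n. 1 \<le> n \<Longrightarrow>
    norm (trapezoid_sum s n - (s - 1) * zeta s) \<le> C * real n powr (- Re s - 1)"
proof -
  define p where "p = Re s + 1"
  have p: "0 < p" using s by (simp add: p_def)
  define K where "K = 3 * norm ((1 - s) gchoose 3) + norm ((1 - s) / 2) * (2 * norm ((- s) gchoose 2))"
  have K: "0 \<le> K" by (simp add: K_def)
  have step: "norm (trapezoid_sum s (Suc n) - trapezoid_sum s n) \<le> K * real n powr (- p - 1)"
    if n: "1 \<le> n" for n
  proof -
    have "norm (binomial_rem 3 (1 - s) n) \<le> 3 * norm ((1 - s) gchoose 3) * real n powr (- p - 1)"
      using norm_binomial_rem_le[of n 3 "1 - s"] n s by (simp add: p_def)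
    moreover have "norm (binomial_rem 2 (- s) n) \<le> 2 * norm ((- s) gchoose 2) * real n powr (- p - 1)"
      using norm_binomial_rem_le[of n 2 "- s"] n s by (simp add: p_def algebra_simps)
    then have "norm ((1 - s) / 2 * binomial_rem 2 (- s) n)
        \<le> norm ((1 - s) / 2) * (2 * norm ((- s) gchoose 2) * real n powr (- p - 1))"
      unfolding norm_mult by (intro mult_left_mono) auto
    ultimately show ?thesis
      unfolding trapezoid_sum_Suc_diff[OF n] K_def
      using norm_triangle_ineq4[of "binomial_rem 3 (1 - s) n" "(1 - s) / 2 * binomial_rem 2 (- s) n"]
      by (simp add: algebra_simps)
  qed
  define C where "C = K * (2 powr (p + 1) / p)"
  have C: "0 \<le> C" using K p by (simp add: C_def)
  show ?thesis
  proof (rule that[of C])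
    fix n :: nat assume n: "1 \<le> n"
    have "norm (trapezoid_sum s n - (s - 1) * zeta s) \<le> C * real n powr (- p)"
    proof (rule norm_limit_diff_le[OF trapezoid_sum_tendsto[OF s]])
      fix k assume k: "n \<le> k"
      have "norm (trapezoid_sum s (Suc k) - trapezoid_sum s k) \<le> K * real k powr (- p - 1)"
        using n k by (intro step) simp
      also have "\<dots> \<le> K * (2 powr (p + 1) / p * (real k powr (- p) - real (Suc k) powr (- p)))"
        using n k K p by (intro mult_left_mono powr_le_telescope) auto
      finally show "norm (trapezoid_sum s (Suc k) - trapezoid_sum s k)
          \<le> C * real k powr (- p) - C * real (Suc k) powr (- p)"
        by (simp add: C_def algebra_simps)
    qed (use C in auto)
    then show "norm (trapezoid_sum s n - (s - 1) * zeta s) \<le> C * real n powr (- Re s - 1)"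
      by (simp add: p_def)
  qed
qed

text \<open>The zeta value is the constant term in the comparison of the trapezoid sum of a power with its
  integral. Both exponents \<open>a = \<alpha>\<close> and \<open>a = \<alpha> - 1\<close> lie in the range, although the Dirichlet
  series diverges there. The next Euler-Maclaurin term has the order of the error bound, which is
  exactly what second order accuracy of the scheme requires.\<close>
lemma zeta_tail_asymptotics:
  fixes a :: real
  assumes a: "a > -1" "a \<noteq> 1"
  obtains C where "\<And>n. 1 \<le> n \<Longrightarrow>
    \<bar>zeta_tail n a + real n powr (- a) / 2 - real n powr (1 - a) / (1 - a)\<bar> \<le> C * real n powr (- a - 1)"
proof -
  have ne: "(of_real a :: complex) \<noteq> 1" using a by (metis of_real_1 of_real_eq_iff)
  obtain C where C: "\<And>n. 1 \<le> n \<Longrightarrow>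
    norm (trapezoid_sum (of_real a) n - (of_real a - 1) * zeta (of_real a)) \<le> C * real n powr (- a - 1)"
    using trapezoid_sum_error[of "of_real a"] a ne by auto
  show ?thesis
  proof (rule that[of "C / \<bar>a - 1\<bar>"])
    fix n :: nat assume n: "1 \<le> n"
    have pw: "of_nat k powr (of_real b :: complex) = of_real (real k powr b)" for k b
      by (metis of_real_of_nat_eq of_nat_0_le_iff powr_of_real)
    have "trapezoid_sum (of_real a) n = of_real ((a - 1) *
        ((\<Sum>k = 1..n - 1. real k powr (- a)) + real n powr (- a) / 2) + real n powr (1 - a))"
      unfolding trapezoid_sum_def
      using pw[of _ "- a"] pw[of _ "1 - a"] by simp
    then have "Re (trapezoid_sum (of_real a) n - (of_real a - 1) * zeta (of_real a))
        = (a - 1) * ((\<Sum>k = 1..n - 1. real k powr (- a)) + real n powr (- a) / 2) + real n powr (1 - a)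
            - (a - 1) * zeta_real a"
      by (simp add: zeta_real_def)
    also have "\<dots> = (a - 1) * (zeta_tail n a + real n powr (- a) / 2 - real n powr (1 - a) / (1 - a))"
      using a by (simp add: zeta_tail_def field_simps)
    finally have "\<bar>a - 1\<bar> * \<bar>zeta_tail n a + real n powr (- a) / 2 - real n powr (1 - a) / (1 - a)\<bar>
        \<le> C * real n powr (- a - 1)"
      using abs_Re_le_cmod[of "trapezoid_sum (of_real a) n - (of_real a - 1) * zeta (of_real a)"] C[OF n]
      by (simp add: abs_mult)
    then show "\<bar>zeta_tail n a + real n powr (- a) / 2 - real n powr (1 - a) / (1 - a)\<bar>
        \<le> C / \<bar>a - 1\<bar> * real n powr (- a - 1)"
      using a by (simp add: field_simps)
  qed
qed

section \<open>Trapezoid rule and variation of the derivative\<close>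

text \<open>Bounding the error by the variation of the first derivative, instead of a bound on the second,
  costs no smoothness at the end points, and such bounds telescope over adjacent intervals.\<close>
lemma trapezoid_error_le:
  fixes f f' :: "real \<Rightarrow> real"
  assumes "a < b" and cont: "continuous_on {a..b} f"
    and deriv: "\<And>t. a < t \<Longrightarrow> t < b \<Longrightarrow> (f has_real_derivative f' t) (at t)"
    and var: "\<And>s t. a < s \<Longrightarrow> s \<le> t \<Longrightarrow> t < b \<Longrightarrow> \<bar>f' t - f' s\<bar> \<le> V"
  shows "\<bar>integral {a..b} f - (b - a) * (f a + f b) / 2\<bar> \<le> (b - a)\<^sup>2 * V / 2"
proof -
  define P where "P = (\<lambda>t. integral {a..t} f - (t - a) * (f a + f t) / 2)"
  have V: "0 \<le> V"
    using var[of "(a + b) / 2" "(a + b) / 2"] \<open>a < b\<close> by simp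
  have P': "(P has_real_derivative (f t - f a) / 2 - (t - a) * f' t / 2) (at t)" if t: "a < t" "t < b" for t
  proof -
    have "((\<lambda>t. integral {a..t} f) has_real_derivative f t) (at t)"
      using integral_has_real_derivative[OF cont, of t] t at_within_Icc_at[of a t b] by simp
    then show ?thesis
      unfolding P_def
      by (auto intro!: derivative_eq_intros deriv[OF t] simp: field_simps)
  qed
  have "continuous_on {a..b} P"
    unfolding P_def
    by (intro continuous_intros cont indefinite_integral_continuous_1 integrable_continuous_interval) auto
  then obtain l t where t: "a < t" "t < b" "DERIV P t :> l" "P b - P a = (b - a) * l"
    using MVT[of a b P] \<open>a < b\<close> P' real_differentiable_def by blast
  \<comment> \<open>A second use of the mean value theorem turns this derivative into
    \<open>(t - a) / 2 * (f' u - f' t)\<close>.\<close>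
  have l: "l = (f t - f a) / 2 - (t - a) * f' t / 2"
    using DERIV_unique[OF t(3) P'[OF t(1,2)]] .
  have "continuous_on {a..t} f" using t by (intro continuous_on_subset[OF cont]) auto
  moreover have "f differentiable (at u)" if "a < u" "u < t" for u
    using deriv[of u] that t real_differentiable_def by auto
  ultimately obtain m u where u: "a < u" "u < t" "DERIV f u :> m" "f t - f a = (t - a) * m"
    using MVT[OF t(1), of f] by blast
  have m: "m = f' u" using DERIV_unique[OF u(3) deriv] u t by auto
  have "2 * \<bar>l\<bar> = (t - a) * \<bar>f' t - f' u\<bar>"
    using t(1) unfolding l u(4) m by (simp add: abs_mult abs_minus_commute flip: diff_divide_distrib right_diff_distrib)
  also have "\<dots> \<le> (b - a) * V"
    using t u V by (intro mult_mono var) auto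
  finally have "\<bar>l\<bar> \<le> (b - a) * V / 2" by simp
  then have "(b - a) * \<bar>l\<bar> \<le> (b - a) * ((b - a) * V / 2)"
    using \<open>a < b\<close> by (intro mult_left_mono) auto
  moreover have "P a = 0" by (simp add: P_def)
  ultimately show ?thesis
    using t(4) \<open>a < b\<close> by (simp add: P_def abs_mult power2_eq_square)
qed

text \<open>The function \<open>G\<close> stands for an antiderivative of a majorant of the second derivative. The second
  derivative may be unbounded near 0 as long as \<open>G\<close> is bounded, so integrable singularities
  do not spoil the order \<open>h\<^sup>2\<close>.\<close>
lemma composite_trapezoid_error_le:
  fixes f f' G :: "real \<Rightarrow> real"
  assumes h: "0 < h" and n: "1 \<le> n" and cont: "continuous_on {0..real n * h} f"
    and deriv: "\<And>t. 0 < t \<Longrightarrow> t < real n * h \<Longrightarrow> (f has_real_derivative f' t) (at t)"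
    and var: "\<And>s t. 0 < s \<Longrightarrow> s \<le> t \<Longrightarrow> t < real n * h \<Longrightarrow> \<bar>f' t - f' s\<bar> \<le> G t - G s"
    and G: "mono_on {0..real n * h} G"
  shows "\<bar>h * ((\<Sum>k = 1..n - 1. f (real k * h)) + (f 0 + f (real n * h)) / 2)
           - integral {0..real n * h} f\<bar> \<le> h\<^sup>2 * (G (real n * h) - G 0) / 2"
proof -
  have "\<bar>h * (\<Sum>k<m. (f (real k * h) + f (real (Suc k) * h)) / 2) - integral {0..real m * h} f\<bar>
     \<le> h\<^sup>2 * (G (real m * h) - G 0) / 2" if "m \<le> n" for m
    using that
  proof (induction m)
    case (Suc m)
    define a where "a = real m * h"
    define b where "b = real (Suc m) * h"
    have ab: "a < b" "b - a = h" "0 \<le> a" using h by (auto simp: a_def b_def algebra_simps)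
    have bn: "b \<le> real n * h" using Suc.prems h unfolding b_def by (intro mult_right_mono) auto
    have "\<bar>integral {a..b} f - (b - a) * (f a + f b) / 2\<bar> \<le> (b - a)\<^sup>2 * (G b - G a) / 2"
    proof (rule trapezoid_error_le[where f' = f'])
      show "continuous_on {a..b} f" using cont ab bn by (auto intro: continuous_on_subset)
      fix s t assume st: "a < s" "s \<le> t" "t < b"
      have "G a \<le> G s" "G t \<le> G b" using st ab bn by (auto intro!: mono_onD[OF G])
      moreover have "\<bar>f' t - f' s\<bar> \<le> G t - G s" using st ab bn by (intro var) auto
      ultimately show "\<bar>f' t - f' s\<bar> \<le> G b - G a" by linarith
    qed (use deriv ab bn in auto)
    moreover have "integral {0..a} f + integral {a..b} f = integral {0..b} f"
    proof (rule Henstock_Kurzweil_Integration.integral_combine)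
      show "f integrable_on {0..b}"
        using cont bn by (intro integrable_continuous_interval) (auto intro: continuous_on_subset)
    qed (use ab in auto)
    moreover have "\<bar>h * (\<Sum>k<m. (f (real k * h) + f (real (Suc k) * h)) / 2) - integral {0..a} f\<bar>
        \<le> h\<^sup>2 * (G a - G 0) / 2"
      using Suc by (simp add: a_def)
    moreover have "h * (\<Sum>k<Suc m. (f (real k * h) + f (real (Suc k) * h)) / 2)
        = h * (\<Sum>k<m. (f (real k * h) + f (real (Suc k) * h)) / 2) + h * (f a + f b) / 2"
      by (simp add: a_def b_def algebra_simps)
    moreover have "h\<^sup>2 * (G b - G 0) / 2 = h\<^sup>2 * (G a - G 0) / 2 + h\<^sup>2 * (G b - G a) / 2"
      by (simp add: field_simps)
    ultimately show ?case
      unfolding ab(2) b_def[symmetric] by linarith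
  qed simp
  from this[of n] have *: "\<bar>h * (\<Sum>k<n. (f (real k * h) + f (real (Suc k) * h)) / 2)
      - integral {0..real n * h} f\<bar> \<le> h\<^sup>2 * (G (real n * h) - G 0) / 2" by simp
  have "(\<Sum>k<n. (g k + g (Suc k)) / 2) = (\<Sum>k = 1..n - 1. g k) + (g 0 + g n) / 2" for g :: "nat \<Rightarrow> real"
    using n
  proof (induction n rule: dec_induct)
    case (step m)
    then have "{1..m} = insert m {1..m - 1}" by auto
    then have "(\<Sum>k = 1..m. g k) = g m + (\<Sum>k = 1..m - 1. g k)"
      using step by (simp add: Suc_le_eq)
    with step.IH show ?case by (simp add: field_simps)
  qed simp
  from this[of "\<lambda>k. f (real k * h)"] * show ?thesis by simp
qed

lemma has_integral_reflect_shift: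
  fixes g :: "real \<Rightarrow> real"
  assumes "(g has_integral I) {0..x}"
  shows "((\<lambda>t. g (x - t)) has_integral I) {0..x}"
proof -
  have "(\<lambda>t. (1 / - 1) *\<^sub>R t + - ((1 / - 1) *\<^sub>R x)) ` cbox 0 x = {0..x}"
    by (auto simp: image_iff intro!: bexI[of _ "x - _"])
  then show ?thesis
    using has_integral_affinity[of g I 0 x "-1" x] assms by (simp add: algebra_simps)
qed

section \<open>Trapezoid rule for an algebraic singularity\<close>

text \<open>After the Taylor polynomial of degree one is removed, the second derivative of the singular
  product is at most \<open>5 * B * u powr (- \<alpha>)\<close>: the three terms of the product rule contribute
  \<open>B\<close>, \<open>2 * \<alpha> * B\<close> and \<open>\<alpha> * (\<alpha> + 1) * B\<close> times \<open>u powr (- \<alpha>)\<close>. This is integrable, so the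
  ordinary trapezoid rule has second order.\<close>
lemma singular_remainder_trapezoid:
  fixes \<phi> \<phi>' \<phi>'' :: "real \<Rightarrow> real" and \<alpha> x B :: real
  assumes \<alpha>: "0 < \<alpha>" "\<alpha> < 1" and x: "0 < x"
    and d1: "\<And>u. u \<in> {0..x} \<Longrightarrow> (\<phi> has_real_derivative \<phi>' u) (at u within {0..x})"
    and d2: "\<And>u. u \<in> {0..x} \<Longrightarrow> (\<phi>' has_real_derivative \<phi>'' u) (at u within {0..x})"
    and B: "\<And>u. u \<in> {0..x} \<Longrightarrow> \<bar>\<phi>'' u\<bar> \<le> B"
  defines "R \<equiv> \<lambda>u. u powr (- \<alpha>) * (\<phi> u - \<phi> 0 - \<phi>' 0 * u)"
  shows "continuous_on {0..x} R"
    and "1 \<le> n \<Longrightarrow> \<bar>x / real n * ((\<Sum>k = 1..n - 1. R (real k * (x / real n))) + R x / 2) - integral {0..x} R\<bar>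
       \<le> (x / real n)\<^sup>2 * (5 * B * x powr (1 - \<alpha>) / (1 - \<alpha>)) / 2"
proof -
  define r where "r = (\<lambda>u. \<phi> u - \<phi> 0 - \<phi>' 0 * u)"
  define r' where "r' = (\<lambda>u. \<phi>' u - \<phi>' 0)"
  have B0: "0 \<le> B" using B[of 0] x by simp
  have r'_le: "\<bar>r' u\<bar> \<le> B * u" if u: "u \<in> {0..x}" for u
    using field_differentiable_bound[of "{0..x}" \<phi>' \<phi>'' B u 0] d2 B u x by (simp add: r'_def)
  have r_le: "\<bar>r u\<bar> \<le> B * u\<^sup>2" if u: "u \<in> {0..x}" for u
  proof -
    have "((\<lambda>v. r v) has_real_derivative r' v) (at v within {0..u})" if "v \<in> {0..u}" for v
      unfolding r_def r'_def using that u
      by (auto intro!: derivative_eq_intros DERIV_subset[OF d1])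
    moreover have "\<bar>r' v\<bar> \<le> B * u" if "v \<in> {0..u}" for v
      using r'_le[of v] that u mult_left_mono[OF _ B0, of v u] by auto
    ultimately have "norm (r u - r 0) \<le> B * u * norm (u - 0)"
      using u by (intro field_differentiable_bound[of "{0..u}"]) auto
    then show ?thesis using u by (simp add: r_def power2_eq_square mult.assoc)
  qed
  define R' where "R' = (\<lambda>u. u powr (- \<alpha>) * r' u - \<alpha> * u powr (- \<alpha> - 1) * r u)"
  define R'' where "R'' = (\<lambda>u. u powr (- \<alpha>) * \<phi>'' u - 2 * \<alpha> * u powr (- \<alpha> - 1) * r' u
      + \<alpha> * (\<alpha> + 1) * u powr (- \<alpha> - 2) * r u)"
  define G where "G = (\<lambda>u. 5 * B * u powr (1 - \<alpha>) / (1 - \<alpha>))"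
  have dr: "(r has_real_derivative r' u) (at u)" "(r' has_real_derivative \<phi>'' u) (at u)"
    if "0 < u" "u < x" for u
    unfolding r_def r'_def
    using d1[of u] d2[of u] at_within_Icc_at[of 0 u x] that
    by (auto intro!: derivative_eq_intros)
  have dR: "(R has_real_derivative R' u) (at u)" if u: "0 < u" "u < x" for u
    unfolding R_def R'_def r_def[symmetric] using u
    by (auto intro!: derivative_eq_intros dr simp: fun_cong[OF r_def, symmetric])
  have dR': "(R' has_real_derivative R'' u) (at u)" if u: "0 < u" "u < x" for u
    unfolding R'_def R''_def using u
    by (auto intro!: derivative_eq_intros dr simp: algebra_simps)
  have R''_le: "\<bar>R'' u\<bar> \<le> 5 * B * u powr (- \<alpha>)" if u: "0 < u" "u < x" for u
  proof -
    have p1: "u powr (- \<alpha>) = u powr (- \<alpha> - 1) * u"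
      using powr_add[of u "- \<alpha> - 1" 1] u by simp
    have p2: "u powr (- \<alpha>) = u powr (- \<alpha> - 2) * u\<^sup>2"
      using powr_add[of u "- \<alpha> - 2" 2] u by simp
    have "\<bar>u powr (- \<alpha>) * \<phi>'' u\<bar> \<le> u powr (- \<alpha>) * B"
      using B[of u] u by (auto simp: abs_mult intro!: mult_left_mono)
    moreover have "\<bar>2 * \<alpha> * u powr (- \<alpha> - 1) * r' u\<bar> \<le> 2 * (u powr (- \<alpha>) * B)"
    proof -
      have *: "u powr (- \<alpha> - 1) * \<bar>r' u\<bar> \<le> u powr (- \<alpha> - 1) * (B * u)"
        using r'_le[of u] u by (intro mult_left_mono) auto
      have "\<alpha> * (u powr (- \<alpha> - 1) * \<bar>r' u\<bar>) \<le> 1 * (u powr (- \<alpha> - 1) * (B * u))"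
        using \<alpha> by (intro mult_mono[OF _ *]) auto
      then show ?thesis using \<alpha> by (simp add: abs_mult p1 mult_ac)
    qed
    moreover have "\<bar>\<alpha> * (\<alpha> + 1) * u powr (- \<alpha> - 2) * r u\<bar> \<le> 2 * (u powr (- \<alpha>) * B)"
    proof -
      have *: "u powr (- \<alpha> - 2) * \<bar>r u\<bar> \<le> u powr (- \<alpha> - 2) * (B * u\<^sup>2)"
        using r_le[of u] u by (intro mult_left_mono) auto
      have "\<alpha> * (\<alpha> + 1) \<le> 1 * 2"
        using \<alpha> by (intro mult_mono) auto
      then have "\<alpha> * (\<alpha> + 1) * (u powr (- \<alpha> - 2) * \<bar>r u\<bar>) \<le> 2 * (u powr (- \<alpha> - 2) * (B * u\<^sup>2))"
        by (intro mult_mono[OF _ *]) auto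
      then show ?thesis using \<alpha> by (simp add: abs_mult p2 mult_ac)
    qed
    ultimately show ?thesis
      unfolding R''_def by (simp only: mult_ac)
  qed
  have dG: "(G has_real_derivative 5 * B * u powr (- \<alpha>)) (at u)" if "0 < u" for u
    unfolding G_def using that \<alpha> by (auto intro!: derivative_eq_intros)
  have var: "\<bar>R' t - R' s\<bar> \<le> G t - G s" if st: "0 < s" "s \<le> t" "t < x" for s t
  proof -
    have "G s - R' s \<le> G t - R' t"
    proof (rule DERIV_nonneg_imp_nondecreasing[OF st(2)])
      fix u assume "s \<le> u" "u \<le> t"
      then show "\<exists>y. ((\<lambda>u. G u - R' u) has_real_derivative y) (at u) \<and> 0 \<le> y"
        using R''_le[of u] st
        by (intro exI[of _ "5 * B * u powr (- \<alpha>) - R'' u"] conjI DERIV_diff dG dR') auto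
    qed
    moreover have "G s + R' s \<le> G t + R' t"
    proof (rule DERIV_nonneg_imp_nondecreasing[OF st(2)])
      fix u assume "s \<le> u" "u \<le> t"
      then show "\<exists>y. ((\<lambda>u. G u + R' u) has_real_derivative y) (at u) \<and> 0 \<le> y"
        using R''_le[of u] st
        by (intro exI[of _ "5 * B * u powr (- \<alpha>) + R'' u"] conjI DERIV_add dG dR') auto
    qed
    ultimately show ?thesis by linarith
  qed
  have cont_\<phi>: "continuous_on {0..x} \<phi>"
    using d1 DERIV_continuous continuous_on_eq_continuous_within by blast
  show contR: "continuous_on {0..x} R"
    unfolding continuous_on_eq_continuous_within
  proof
    fix u assume u: "u \<in> {0..x}"
    show "continuous (at u within {0..x}) R"
    proof (cases "u = 0")
      case True
      have "((\<lambda>v. B * v powr (2 - \<alpha>)) \<longlongrightarrow> B * 0 powr (2 - \<alpha>)) (at 0 within {0..x})"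
      proof -
        have "continuous_on {0..x} (\<lambda>v. B * v powr (2 - \<alpha>))"
          using \<alpha> by (intro continuous_intros continuous_on_powr') auto
        from this[unfolded continuous_on_def, THEN bspec, of 0] x show ?thesis by simp
      qed
      then have lim: "((\<lambda>v. B * v powr (2 - \<alpha>)) \<longlongrightarrow> 0) (at 0 within {0..x})" by simp
      have "norm (R v) \<le> B * v powr (2 - \<alpha>)" if v: "v \<in> {0..x}" for v
      proof -
        have "norm (R v) = v powr (- \<alpha>) * \<bar>r v\<bar>" by (simp add: R_def r_def abs_mult)
        also have "\<dots> \<le> v powr (- \<alpha>) * (B * v\<^sup>2)"
          using r_le[OF v] by (intro mult_left_mono) auto
        also have "\<dots> = B * v powr (2 - \<alpha>)"
          using powr_add[of v "- \<alpha>" 2] v by (cases "v = 0") (auto simp: algebra_simps)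
        finally show ?thesis .
      qed
      then have "(R \<longlongrightarrow> 0) (at 0 within {0..x})"
        by (intro Lim_null_comparison[OF _ lim]) (auto simp: eventually_at_filter)
      then show ?thesis using True by (simp add: continuous_within R_def)
    next
      case False
      then have "continuous (at u within {0..x}) \<phi>" "u > 0"
        using cont_\<phi> u by (auto simp: continuous_on_eq_continuous_within)
      then show ?thesis
        unfolding R_def by (intro continuous_intros) auto
    qed
  qed
  assume n: "1 \<le> n"
  have "\<bar>x / real n * ((\<Sum>k = 1..n - 1. R (real k * (x / real n))) + (R 0 + R (real n * (x / real n))) / 2)
           - integral {0..real n * (x / real n)} R\<bar>
       \<le> (x / real n)\<^sup>2 * (G (real n * (x / real n)) - G 0) / 2"
  proof (rule composite_trapezoid_error_le[where f' = R'])
    show "mono_on {0..real n * (x / real n)} G"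
      unfolding G_def using \<alpha> B0
      by (auto intro!: mono_onI divide_right_mono mult_left_mono powr_mono2)
  qed (use n x contR dR var in auto)
  then show "\<bar>x / real n * ((\<Sum>k = 1..n - 1. R (real k * (x / real n))) + R x / 2) - integral {0..x} R\<bar>
       \<le> (x / real n)\<^sup>2 * (5 * B * x powr (1 - \<alpha>) / (1 - \<alpha>)) / 2"
    using n by (simp add: G_def R_def)
qed

text \<open>The trapezoid rule for an integrand with a power singularity at 0, corrected by zeta values. The
  integrand is split into \<open>u powr (- \<alpha>)\<close>, \<open>u powr (1 - \<alpha>)\<close> and a remainder. For the two powers the
  discrepancy between sum and integral is given by \<open>zeta_tail_asymptotics\<close>, and the remainder
  needs no correction.\<close>
lemma singular_trapezoid:
  fixes \<phi> \<phi>' \<phi>'' :: "real \<Rightarrow> real" and \<alpha> x B :: real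
  assumes \<alpha>: "0 < \<alpha>" "\<alpha> < 1" and x: "0 < x"
    and d1: "\<And>u. u \<in> {0..x} \<Longrightarrow> (\<phi> has_real_derivative \<phi>' u) (at u within {0..x})"
    and d2: "\<And>u. u \<in> {0..x} \<Longrightarrow> (\<phi>' has_real_derivative \<phi>'' u) (at u within {0..x})"
    and B: "\<And>u. u \<in> {0..x} \<Longrightarrow> \<bar>\<phi>'' u\<bar> \<le> B"
  obtains I C where "((\<lambda>u. \<phi> u / u powr \<alpha>) has_integral I) {0..x}"
    and "\<And>n. 1 \<le> n \<Longrightarrow>
      \<bar>(x / real n) powr (1 - \<alpha>) *
          ((\<Sum>k = 1..n - 1. real k powr (- \<alpha>) * \<phi> (real k * (x / real n)))
            + real n powr (- \<alpha>) * \<phi> x / 2 - zeta_real \<alpha> * \<phi> 0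
            - zeta_real (\<alpha> - 1) * (x / real n) * \<phi>' 0) - I\<bar> \<le> C / (real n)\<^sup>2"
proof -
  define R where "R = (\<lambda>u. u powr (- \<alpha>) * (\<phi> u - \<phi> 0 - \<phi>' 0 * u))"
  have contR: "continuous_on {0..x} R"
    unfolding R_def by (rule singular_remainder_trapezoid(1)[OF \<alpha> x d1 d2 B])
  have trapR: "\<bar>x / real n * ((\<Sum>k = 1..n - 1. R (real k * (x / real n))) + R x / 2) - integral {0..x} R\<bar>
       \<le> (x / real n)\<^sup>2 * (5 * B * x powr (1 - \<alpha>) / (1 - \<alpha>)) / 2" if "1 \<le> n" for n
    unfolding R_def by (rule singular_remainder_trapezoid(2)[of \<alpha> x \<phi> \<phi>' \<phi>'' B n]) (fact \<alpha> x d1 d2 B that)+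
  obtain C1 where C1: "\<And>n. 1 \<le> n \<Longrightarrow>
    \<bar>zeta_tail n \<alpha> + real n powr (- \<alpha>) / 2 - real n powr (1 - \<alpha>) / (1 - \<alpha>)\<bar> \<le> C1 * real n powr (- \<alpha> - 1)"
    using zeta_tail_asymptotics[of \<alpha>] \<alpha> by auto
  obtain C2 where C2: "\<And>n. 1 \<le> n \<Longrightarrow>
    \<bar>zeta_tail n (\<alpha> - 1) + real n powr (1 - \<alpha>) / 2 - real n powr (2 - \<alpha>) / (2 - \<alpha>)\<bar> \<le> C2 * real n powr (- \<alpha>)"
    using zeta_tail_asymptotics[of "\<alpha> - 1"] \<alpha> by auto
  define I where "I = \<phi> 0 * (x powr (1 - \<alpha>) / (1 - \<alpha>)) + \<phi>' 0 * (x powr (2 - \<alpha>) / (2 - \<alpha>))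
      + integral {0..x} R"
  define C where "C = x\<^sup>2 * (5 * B * x powr (1 - \<alpha>) / (1 - \<alpha>)) / 2
      + \<bar>\<phi> 0\<bar> * (x powr (1 - \<alpha>) * C1) + \<bar>\<phi>' 0\<bar> * (x powr (2 - \<alpha>) * C2)"
  have powr_split: "u powr (1 - \<alpha>) = u powr (- \<alpha>) * u" "u powr (2 - \<alpha>) = u powr (- \<alpha>) * u * u"
    if "0 \<le> u" for u
    using that powr_add[of u "- \<alpha>" 1] powr_add[of u "- \<alpha>" 2]
    by (cases "u = 0"; simp add: power2_eq_square)+
  have decomp: "u powr (- \<alpha>) * \<phi> u = \<phi> 0 * u powr (- \<alpha>) + \<phi>' 0 * u powr (1 - \<alpha>) + R u"
    if "0 \<le> u" for u
    unfolding R_def powr_split[OF that] by (simp add: algebra_simps)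
  show ?thesis
  proof (rule that[of I C])
    have "((\<lambda>u. \<phi> 0 * u powr (- \<alpha>) + \<phi>' 0 * u powr (1 - \<alpha>) + R u) has_integral I) {0..x}"
      unfolding I_def
      using has_integral_powr_from_0[of "- \<alpha>" x] has_integral_powr_from_0[of "1 - \<alpha>" x] \<alpha> x
      by (intro has_integral_add has_integral_mult_right integrable_integral
                integrable_continuous_interval contR) (auto simp: algebra_simps)
    then show "((\<lambda>u. \<phi> u / u powr \<alpha>) has_integral I) {0..x}"
      by (rule has_integral_eq[rotated]) (use decomp in \<open>auto simp: powr_minus_divide\<close>)
  next
    fix n :: nat assume n: "1 \<le> n"
    define h where "h = x / real n"
    have h: "0 < h" "real n * h = x" using n x by (auto simp: h_def)
    define T where "T = h * ((\<Sum>k = 1..n - 1. R (real k * h)) + R x / 2)"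
    define e1 where "e1 = zeta_tail n \<alpha> + real n powr (- \<alpha>) / 2 - real n powr (1 - \<alpha>) / (1 - \<alpha>)"
    define e2 where "e2 = zeta_tail n (\<alpha> - 1) + real n powr (1 - \<alpha>) / 2 - real n powr (2 - \<alpha>) / (2 - \<alpha>)"
    have pt: "h powr (1 - \<alpha>) * (real k powr (- \<alpha>) * \<phi> (real k * h))
        = \<phi> 0 * h powr (1 - \<alpha>) * real k powr (- \<alpha>)
          + \<phi>' 0 * h powr (2 - \<alpha>) * real k powr (1 - \<alpha>) + h * R (real k * h)" for k
    proof -
      have "h powr (1 - \<alpha>) * (real k powr (- \<alpha>) * \<phi> (real k * h))
          = h * ((real k * h) powr (- \<alpha>) * \<phi> (real k * h))"
        using h by (simp add: powr_mult powr_split)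
      also have "\<dots> = h * (\<phi> 0 * (real k * h) powr (- \<alpha>) + \<phi>' 0 * (real k * h) powr (1 - \<alpha>) + R (real k * h))"
        using h by (subst decomp) auto
      also have "\<dots> = \<phi> 0 * h powr (1 - \<alpha>) * real k powr (- \<alpha>)
          + \<phi>' 0 * h powr (2 - \<alpha>) * real k powr (1 - \<alpha>) + h * R (real k * h)"
        using h by (simp add: powr_mult powr_split algebra_simps)
      finally show ?thesis .
    qed
    have sum: "h powr (1 - \<alpha>) * (\<Sum>k = 1..n - 1. real k powr (- \<alpha>) * \<phi> (real k * h))
        = \<phi> 0 * h powr (1 - \<alpha>) * (\<Sum>k = 1..n - 1. real k powr (- \<alpha>))
          + \<phi>' 0 * h powr (2 - \<alpha>) * (\<Sum>k = 1..n - 1. real k powr (1 - \<alpha>))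
          + h * (\<Sum>k = 1..n - 1. R (real k * h))"
      by (simp only: sum_distrib_left pt sum.distrib)
    have x1: "x powr (1 - \<alpha>) = h powr (1 - \<alpha>) * real n powr (1 - \<alpha>)"
      and x2: "x powr (2 - \<alpha>) = h powr (2 - \<alpha>) * real n powr (2 - \<alpha>)"
      using h by (metis mult.commute powr_mult)+
    have "h powr (1 - \<alpha>) * ((\<Sum>k = 1..n - 1. real k powr (- \<alpha>) * \<phi> (real k * h))
            + real n powr (- \<alpha>) * \<phi> x / 2 - zeta_real \<alpha> * \<phi> 0 - zeta_real (\<alpha> - 1) * h * \<phi>' 0) - I
       = (T - integral {0..x} R) + \<phi> 0 * (h powr (1 - \<alpha>) * e1) + \<phi>' 0 * (h powr (2 - \<alpha>) * e2)"
    proof -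
      have hh: "h powr (2 - \<alpha>) = h powr (1 - \<alpha>) * h"
        using h by (simp add: powr_split)
      have nn: "h powr (1 - \<alpha>) * (real n powr (- \<alpha>) * \<phi> x)
        = \<phi> 0 * h powr (1 - \<alpha>) * real n powr (- \<alpha>)
          + \<phi>' 0 * h powr (2 - \<alpha>) * real n powr (1 - \<alpha>) + h * R x"
        using pt[of n] h(2) by simp
      have zeta: "zeta_real \<alpha> = (\<Sum>k = 1..n - 1. real k powr (- \<alpha>)) - zeta_tail n \<alpha>"
        "zeta_real (\<alpha> - 1) = (\<Sum>k = 1..n - 1. real k powr (1 - \<alpha>)) - zeta_tail n (\<alpha> - 1)"
        by (simp_all add: zeta_tail_def)
      have "h powr (1 - \<alpha>) * ((\<Sum>k = 1..n - 1. real k powr (- \<alpha>) * \<phi> (real k * h))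
            + real n powr (- \<alpha>) * \<phi> x / 2 - zeta_real \<alpha> * \<phi> 0 - zeta_real (\<alpha> - 1) * h * \<phi>' 0)
        = h powr (1 - \<alpha>) * (\<Sum>k = 1..n - 1. real k powr (- \<alpha>) * \<phi> (real k * h))
          + h powr (1 - \<alpha>) * (real n powr (- \<alpha>) * \<phi> x) / 2
          - \<phi> 0 * h powr (1 - \<alpha>) * zeta_real \<alpha> - \<phi>' 0 * h powr (2 - \<alpha>) * zeta_real (\<alpha> - 1)"
        unfolding hh by (simp add: algebra_simps)
      then show ?thesis
        unfolding sum nn zeta I_def x1 x2 T_def e1_def e2_def by (simp add: algebra_simps add_divide_distrib)
    qed
    moreover have "\<bar>T - integral {0..x} R\<bar> \<le> x\<^sup>2 * (5 * B * x powr (1 - \<alpha>) / (1 - \<alpha>)) / 2 / (real n)\<^sup>2"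
    proof -
      have "(x / real n)\<^sup>2 * K / 2 = x\<^sup>2 * K / 2 / (real n)\<^sup>2" for K
        by (simp add: power_divide)
      then show ?thesis using trapR[OF n] by (simp only: T_def h_def)
    qed
    moreover
    have p2: "real n powr (-2) = 1 / (real n)\<^sup>2"
      using n by (simp add: powr_minus_divide)
    have m1: "h powr (1 - \<alpha>) * real n powr (- \<alpha> - 1) = x powr (1 - \<alpha>) / (real n)\<^sup>2"
    proof -
      have "real n powr (- \<alpha> - 1) = real n powr (1 - \<alpha>) * real n powr (-2)"
        unfolding powr_add[symmetric] by (rule arg_cong2[where f = "(powr)"]) auto
      then show ?thesis using p2 by (simp add: x1)
    qed
    have m2: "h powr (2 - \<alpha>) * real n powr (- \<alpha>) = x powr (2 - \<alpha>) / (real n)\<^sup>2"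
    proof -
      have "real n powr (- \<alpha>) = real n powr (2 - \<alpha>) * real n powr (-2)"
        unfolding powr_add[symmetric] by (rule arg_cong2[where f = "(powr)"]) auto
      then show ?thesis using p2 by (simp add: x2)
    qed
    have "\<bar>\<phi> 0 * (h powr (1 - \<alpha>) * e1)\<bar> \<le> \<bar>\<phi> 0\<bar> * (h powr (1 - \<alpha>) * (C1 * real n powr (- \<alpha> - 1)))"
      unfolding abs_mult using C1[OF n] by (intro mult_mono) (auto simp: e1_def)
    then have "\<bar>\<phi> 0 * (h powr (1 - \<alpha>) * e1)\<bar> \<le> \<bar>\<phi> 0\<bar> * (x powr (1 - \<alpha>) * C1) / (real n)\<^sup>2"
      using m1 by (simp add: mult_ac)
    moreover have "\<bar>\<phi>' 0 * (h powr (2 - \<alpha>) * e2)\<bar> \<le> \<bar>\<phi>' 0\<bar> * (h powr (2 - \<alpha>) * (C2 * real n powr (- \<alpha>)))"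
      unfolding abs_mult using C2[OF n] by (intro mult_mono) (auto simp: e2_def)
    then have "\<bar>\<phi>' 0 * (h powr (2 - \<alpha>) * e2)\<bar> \<le> \<bar>\<phi>' 0\<bar> * (x powr (2 - \<alpha>) * C2) / (real n)\<^sup>2"
      using m2 by (simp add: mult_ac)
    ultimately show "\<bar>(x / real n) powr (1 - \<alpha>) *
          ((\<Sum>k = 1..n - 1. real k powr (- \<alpha>) * \<phi> (real k * (x / real n)))
            + real n powr (- \<alpha>) * \<phi> x / 2 - zeta_real \<alpha> * \<phi> 0
            - zeta_real (\<alpha> - 1) * (x / real n) * \<phi>' 0) - I\<bar> \<le> C / (real n)\<^sup>2"
      unfolding h_def[symmetric] C_def add_divide_distrib by linarith
  qed
qed

section \<open>The weights as difference quotients\<close>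

text \<open>Summation by parts with step two; the first and last two coefficients are incomplete
  differences of \<open>p\<close>.\<close>
lemma sum_central_differences:
  fixes p f :: "nat \<Rightarrow> real"
  assumes "5 \<le> n"
  shows "(\<Sum>k = 1..n - 1. p k * (f (k - 1) - f (k + 1)))
     = p 1 * f 0 + p 2 * f 1 + (p 3 - p 1) * f 2 + (\<Sum>k = 3..n - 2. (p (k + 1) - p (k - 1)) * f k)
         - p (n - 2) * f (n - 1) - p (n - 1) * f n"
proof -
  obtain m where "n = m + 5" using assms by (metis add.commute le_Suc_ex)
  then show ?thesis
  proof (induction m arbitrary: n)
    case 0
    then have "{1..n - 1} = {1, 2, 3, 4}" "{3..n - 2} = {3}" by auto
    with 0 show ?case by (simp add: algebra_simps eval_nat_numeral)
  next
    case (Suc m)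
    have "{1..n - 1} = insert (m + 5) {1..(m + 5) - 1}" "{3..n - 2} = insert (m + 4) {3..(m + 5) - 2}"
      using Suc.prems by auto
    then show ?case
      using Suc.IH[of "m + 5"] Suc.prems by (simp add: algebra_simps eval_nat_numeral)
  qed
qed

text \<open>The origin of the weights: central differences for the first derivative at the inner nodes,
  one-sided three-point differences for the first and second derivative at the singular end
  point, where the zeta values enter, and a two-point difference at the other end point.\<close>
lemma weight_sum_eq:
  fixes f :: "nat \<Rightarrow> real"
  assumes n: "5 \<le> n"
  shows "(\<Sum>k = 0..n. weight \<alpha> n k * f k) =
      (\<Sum>k = 1..n - 1. real k powr (- \<alpha>) * (f (k - 1) - f (k + 1)))
      - zeta_real \<alpha> * (3 * f 0 - 4 * f 1 + f 2)
      + 2 * zeta_real (\<alpha> - 1) * (f 0 - 2 * f 1 + f 2)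
      + (2 * zeta_tail n \<alpha> - 2 * real n powr (1 - \<alpha>) / (1 - \<alpha>)) * (f n - f (n - 1))"
proof -
  define p where "p = (\<lambda>k. real k powr (- \<alpha>))"
  have p: "1 / (real k) powr \<alpha> = p k" for k by (simp add: p_def powr_minus_divide)
  have pk: "real k powr (- \<alpha>) = p k" for k by (simp add: p_def)
  define c where "c = 2 * zeta_tail n \<alpha> - 2 * real n powr (1 - \<alpha>) / (1 - \<alpha>)"
  have "{0..n} = insert 0 (insert 1 (insert 2 (insert (n - 1) (insert n {3..n - 2}))))"
    using n by auto
  moreover have "0 \<notin> insert 1 (insert 2 (insert (n - 1) (insert n {3..n - 2})))"
    "1 \<notin> insert 2 (insert (n - 1) (insert n {3..n - 2}))"
    "2 \<notin> insert (n - 1) (insert n {3..n - 2})"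
    "n - 1 \<notin> insert n {3..n - 2}" "n \<notin> {3..n - 2}" using n by auto
  ultimately have split: "(\<Sum>k = 0..n. g k)
      = g 0 + (g 1 + (g 2 + (g (n - 1) + (g n + (\<Sum>k = 3..n - 2. g k)))))" for g :: "nat \<Rightarrow> real"
    by (simp only: sum.insert finite_insert finite_atLeastAtMost simp_thms if_False)
  have w0: "weight \<alpha> n 0 = p 1 - 3 * zeta_real \<alpha> + 2 * zeta_real (\<alpha> - 1)"
    by (simp add: weight_def p_def)
  have w1: "weight \<alpha> n 1 = p 2 + 4 * zeta_real \<alpha> - 4 * zeta_real (\<alpha> - 1)"
    using p[of 2] by (simp add: weight_def)
  have w2: "weight \<alpha> n 2 = p 3 - p 1 - zeta_real \<alpha> + 2 * zeta_real (\<alpha> - 1)"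
    using p[of 3] p[of 1] by (simp add: weight_def)
  have wn1: "weight \<alpha> n (n - 1) = - p (n - 2) - c"
  proof -
    have "n - 1 \<noteq> 0" "n - 1 \<noteq> 1" "n - 1 \<noteq> 2" "real (n - 2) = real n - 2" using n by auto
    then show ?thesis using p[of "n - 2"] by (simp only: weight_def if_False simp_thms) (simp add: c_def)
  qed
  have wn: "weight \<alpha> n n = - p (n - 1) + c"
  proof -
    have "n \<noteq> 0" "n \<noteq> 1" "n \<noteq> 2" "n \<noteq> n - 1" "real (n - 1) = real n - 1" using n by auto
    then show ?thesis using p[of "n - 1"] by (simp only: weight_def if_False simp_thms) (simp add: c_def)
  qed
  have wk: "weight \<alpha> n k = p (k + 1) - p (k - 1)" if "k \<in> {3..n - 2}" for k
  proof -
    have k: "k \<noteq> 0" "k \<noteq> 1" "k \<noteq> 2" "k \<noteq> n - 1" "k \<noteq> n"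
      and r: "real k + 1 = real (k + 1)" "real k - 1 = real (k - 1)" using that by auto
    show ?thesis by (simp only: weight_def k r p if_False)
  qed
  have ws: "(\<Sum>k = 3..n - 2. weight \<alpha> n k * f k) = (\<Sum>k = 3..n - 2. (p (k + 1) - p (k - 1)) * f k)"
    by (intro sum.cong refl) (simp add: wk)
  show ?thesis
    unfolding split w0 w1 w2 wn1 wn ws pk sum_central_differences[OF n, of p f] c_def[symmetric]
    by (simp add: algebra_simps)
qed

text \<open>Reflecting by \<open>t \<mapsto> x - t\<close> moves the singularity to 0. The sign \<open>(-1) ^ j\<close> from the chain rule
  is built into \<open>E\<close>, so that each \<open>E (j + 1)\<close> is again the derivative of \<open>E j\<close>.\<close>
lemma smooth_reflected:
  assumes x: "0 < x" and y: "smooth_on_interval 0 x y"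
  obtains E :: "nat \<Rightarrow> real \<Rightarrow> real" and B :: real
  where "\<And>u. u \<in> {0..x} \<Longrightarrow> y (x - u) = E 0 u"
    and "\<And>j u. u \<in> {0..x} \<Longrightarrow> (E j has_real_derivative E (Suc j) u) (at u within {0..x})"
    and "\<And>j u. u \<in> {0..x} \<Longrightarrow> j \<le> 3 \<Longrightarrow> \<bar>E j u\<bar> \<le> B"
    and "\<And>t. t \<in> {0..x} \<Longrightarrow> vector_derivative y (at t within {0..x}) = - E 1 (x - t)"
proof -
  obtain D where D0: "\<And>t. t \<in> {0..x} \<Longrightarrow> D 0 t = y t"
    and D: "\<And>k t. t \<in> {0..x} \<Longrightarrow> (D k has_real_derivative D (Suc k) t) (at t within {0..x})"
    using y unfolding smooth_on_interval_def by blast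
  define E where "E = (\<lambda>j u. (-1) ^ j * D j (x - u))"
  have img: "(\<lambda>u. x - u) ` {0..x} = {0..x}"
    by (auto simp: image_iff intro!: bexI[of _ "x - _"])
  have dE: "(E j has_real_derivative E (Suc j) u) (at u within {0..x})" if u: "u \<in> {0..x}" for j u
  proof -
    have "(D j \<circ> (\<lambda>u. x - u) has_real_derivative D (Suc j) (x - u) * (-1)) (at u within {0..x})"
      by (rule DERIV_image_chain) (use u D[of "x - u" j] in \<open>auto simp: img intro!: derivative_eq_intros\<close>)
    from DERIV_cmult[OF this, of "(-1) ^ j"] show ?thesis
      by (simp add: E_def o_def)
  qed
  have "\<exists>B. \<forall>u\<in>{0..x}. \<bar>E j u\<bar> \<le> B" for j
  proof -
    have "continuous_on {0..x} (E j)"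
      using dE DERIV_continuous continuous_on_eq_continuous_within by blast
    then have "bounded (E j ` {0..x})"
      by (intro compact_imp_bounded compact_continuous_image) auto
    then show ?thesis unfolding bounded_iff by auto
  qed
  then obtain b where b: "\<And>j u. u \<in> {0..x} \<Longrightarrow> \<bar>E j u\<bar> \<le> b j" by metis
  show ?thesis
  proof (rule that[of E "Max (b ` {..3})"])
    fix t assume t: "t \<in> {0..x}"
    have "(D 0 has_vector_derivative D 1 t) (at t within {0..x})"
      using D[OF t, of 0] by (simp add: has_real_derivative_iff_has_vector_derivative)
    then have "(y has_vector_derivative D 1 t) (at t within {0..x})"
      by (rule has_vector_derivative_transform[OF t, rotated]) (simp add: D0)
    then show "vector_derivative y (at t within {0..x}) = - E 1 (x - t)"
      using vector_derivative_within_closed_interval[of 0 x t y "D 1 t"] x t by (simp add: E_def)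
  next
    fix j u assume "u \<in> {0..x}" "j \<le> (3 :: nat)"
    then show "\<bar>E j u\<bar> \<le> Max (b ` {..3})"
      using b[of u j] by (intro order_trans[OF b Max_ge]) auto
  qed (use D0 dE in \<open>auto simp: E_def\<close>)
qed

section \<open>Second order convergence\<close>

text \<open>Taylor expansion at the node. In the central difference the second order terms cancel; the
  coefficients \<open>3, -4, 1\<close> and \<open>1, -2, 1\<close> are those for which the expansions of \<open>E 0 h\<close> and
  \<open>E 0 (2 * h)\<close> leave only the wanted derivative up to third order.\<close>
lemma difference_quotient_errors:
  fixes E :: "nat \<Rightarrow> real \<Rightarrow> real"
  assumes d: "\<And>j u. u \<in> {0..x} \<Longrightarrow> (E j has_real_derivative E (Suc j) u) (at u within {0..x})"
    and B: "\<And>j u. u \<in> {0..x} \<Longrightarrow> j \<le> 3 \<Longrightarrow> \<bar>E j u\<bar> \<le> B"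
    and h: "0 < h" "2 * h \<le> x"
  shows "h \<le> u \<Longrightarrow> u + h \<le> x \<Longrightarrow> \<bar>E 0 (u - h) - E 0 (u + h) + 2 * h * E 1 u\<bar> \<le> 2 * B * h ^ 3"
    and "\<bar>3 * E 0 0 - 4 * E 0 h + E 0 (2 * h) + 2 * h * E 1 0\<bar> \<le> 12 * B * h ^ 3"
    and "\<bar>E 0 0 - 2 * E 0 h + E 0 (2 * h) - h\<^sup>2 * E 2 0\<bar> \<le> 10 * B * h ^ 3"
    and "\<bar>E 0 x - E 0 (x - h) - h * E 1 x\<bar> \<le> B * h\<^sup>2"
    and "\<bar>E 0 x - E 0 (x - h)\<bar> \<le> B * h"
proof -
  have B0: "0 \<le> B" using B[of 0 0] h by auto
  have taylor2: "\<bar>E 0 v - (E 0 u + E 1 u * (v - u) + E 2 u * (v - u)\<^sup>2 / 2)\<bar> \<le> B * \<bar>v - u\<bar> ^ 3"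
    if "u \<in> {0..x}" "v \<in> {0..x}" for u v
  proof -
    have "norm (E 0 v - (\<Sum>i\<le>2. E i u * (v - u) ^ i / fact i)) \<le> B * norm (v - u) ^ Suc 2 / fact 2"
      by (rule field_Taylor[of "{0..x}"]) (use d B that in auto)
    also have "\<dots> \<le> B * \<bar>v - u\<bar> ^ 3"
      using mult_nonneg_nonneg[OF B0, of "\<bar>v - u\<bar> ^ 3"] by (simp add: numeral_3_eq_3)
    finally show ?thesis by (simp add: numeral_2_eq_2 add.assoc)
  qed
  have taylor1: "\<bar>E 0 v - (E 0 u + E 1 u * (v - u))\<bar> \<le> B * \<bar>v - u\<bar>\<^sup>2"
    if "u \<in> {0..x}" "v \<in> {0..x}" for u v
  proof -
    have "norm (E 0 v - (\<Sum>i\<le>1. E i u * (v - u) ^ i / fact i)) \<le> B * norm (v - u) ^ Suc 1 / fact 1"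
      by (rule field_Taylor[of "{0..x}"]) (use d B that in auto)
    then show ?thesis by (simp add: numeral_2_eq_2)
  qed
  show "\<bar>E 0 (u - h) - E 0 (u + h) + 2 * h * E 1 u\<bar> \<le> 2 * B * h ^ 3" if u: "h \<le> u" "u + h \<le> x"
  proof -
    have "\<bar>E 0 (u - h) - (E 0 u + E 1 u * (- h) + E 2 u * h\<^sup>2 / 2)\<bar> \<le> B * h ^ 3"
      using taylor2[of u "u - h"] u h by simp
    moreover have "\<bar>E 0 (u + h) - (E 0 u + E 1 u * h + E 2 u * h\<^sup>2 / 2)\<bar> \<le> B * h ^ 3"
      using taylor2[of u "u + h"] u h by simp
    ultimately show ?thesis by (simp add: mult_ac; linarith)
  qed
  have e1: "\<bar>E 0 h - (E 0 0 + E 1 0 * h + E 2 0 * h\<^sup>2 / 2)\<bar> \<le> B * h ^ 3"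
    using taylor2[of 0 h] h by simp
  have e2: "\<bar>E 0 (2 * h) - (E 0 0 + E 1 0 * (2 * h) + 2 * (E 2 0 * h\<^sup>2))\<bar> \<le> 8 * (B * h ^ 3)"
    using taylor2[of 0 "2 * h"] h by (simp add: power_mult_distrib mult_ac)
  show "\<bar>3 * E 0 0 - 4 * E 0 h + E 0 (2 * h) + 2 * h * E 1 0\<bar> \<le> 12 * B * h ^ 3"
    using e1 e2 by (simp add: mult_ac; linarith)
  show "\<bar>E 0 0 - 2 * E 0 h + E 0 (2 * h) - h\<^sup>2 * E 2 0\<bar> \<le> 10 * B * h ^ 3"
    using e1 e2 by (simp add: mult_ac; linarith)
  show "\<bar>E 0 x - E 0 (x - h) - h * E 1 x\<bar> \<le> B * h\<^sup>2"
    using taylor1[of x "x - h"] h by (simp add: mult_ac; linarith)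
  show "\<bar>E 0 x - E 0 (x - h)\<bar> \<le> B * h"
    using field_differentiable_bound[of "{0..x}" "E 0" "E 1" B x "x - h"] d[of _ 0] B[of _ 1] h by simp
qed

text \<open>The central differences contribute \<open>h ^ 3\<close> times a sum of order \<open>n powr (1 - \<alpha>)\<close>. At the far
  end, \<open>2 * zeta_tail n \<alpha> - 2 * n powr (1 - \<alpha>) / (1 - \<alpha>)\<close> is \<open>- n powr (- \<alpha>)\<close> up to
  \<open>O(n powr (- \<alpha> - 1))\<close>; multiplied by a difference of order \<open>h\<close> it supplies the half weight of
  the end point in the trapezoid rule.\<close>
lemma weight_sum_error:
  fixes E :: "nat \<Rightarrow> real \<Rightarrow> real" and \<alpha> x B :: real
  assumes \<alpha>: "0 < \<alpha>" "\<alpha> < 1" and x: "0 < x"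
    and d: "\<And>j u. u \<in> {0..x} \<Longrightarrow> (E j has_real_derivative E (Suc j) u) (at u within {0..x})"
    and B: "\<And>j u. u \<in> {0..x} \<Longrightarrow> j \<le> 3 \<Longrightarrow> \<bar>E j u\<bar> \<le> B"
  obtains C where "\<And>n. 5 \<le> n \<Longrightarrow>
    \<bar>(\<Sum>k = 0..n. weight \<alpha> n k * E 0 (real k * (x / real n)))
      - 2 * (x / real n) *
          ((\<Sum>k = 1..n - 1. real k powr (- \<alpha>) * (- E 1 (real k * (x / real n))))
            + real n powr (- \<alpha>) * (- E 1 x) / 2 - zeta_real \<alpha> * (- E 1 0)
            - zeta_real (\<alpha> - 1) * (x / real n) * (- E 2 0))\<bar> \<le> C * real n powr (- \<alpha>) / (real n)\<^sup>2"
proof -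
  obtain C1 where C1: "\<And>n. 1 \<le> n \<Longrightarrow>
    \<bar>zeta_tail n \<alpha> + real n powr (- \<alpha>) / 2 - real n powr (1 - \<alpha>) / (1 - \<alpha>)\<bar> \<le> C1 * real n powr (- \<alpha> - 1)"
    using zeta_tail_asymptotics[of \<alpha>] \<alpha> by auto
  have C1_nonneg: "0 \<le> C1" using order_trans[OF abs_ge_zero C1[of 1]] by simp
  have B0: "0 \<le> B" using B[of 0 0] x by auto
  define Z where "Z = \<bar>zeta_real \<alpha>\<bar>"
  define Z1 where "Z1 = \<bar>zeta_real (\<alpha> - 1)\<bar>"
  define K where "K = 1 / (1 - \<alpha>) + C1 + Z"
  define C where "C = 2 * B * K * x ^ 3 + 12 * B * Z * x ^ 3 + 20 * B * Z1 * x ^ 3 + B * x\<^sup>2 + 2 * C1 * B * x"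
  show ?thesis
  proof (rule that[of C])
    fix n :: nat assume n: "5 \<le> n"
    define h where "h = x / real n"
    define q where "q = real n powr (- \<alpha>)"
    have h: "0 < h" "2 * h \<le> x" "real n * h = x"
      using n x by (auto simp: h_def field_simps)
    note err = difference_quotient_errors[where E = E and x = x and B = B, OF d B h(1,2), simplified]
    define f where "f = (\<lambda>k. E 0 (real k * h))"
    define e1 where "e1 = zeta_tail n \<alpha> + q / 2 - real n powr (1 - \<alpha>) / (1 - \<alpha>)"
    have q: "0 \<le> q" "1 \<le> q * real n" "real n powr (1 - \<alpha>) = q * real n" "real n powr (- \<alpha> - 1) = q / real n"
      using n \<alpha> powr_add[of "real n" "- \<alpha>" 1] powr_add[of "real n" "- \<alpha>" "-1"]
        ge_one_powr_ge_zero[of "real n" "1 - \<alpha>"]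
      by (auto simp: q_def powr_minus_divide)
    have e1: "\<bar>e1\<bar> \<le> C1 * q / real n"
      using C1[of n] n by (simp add: e1_def q_def[symmetric] q(4))
    have powr_sum: "(\<Sum>k = 1..n - 1. real k powr (- \<alpha>)) \<le> K * (q * real n)"
    proof -
      have "C1 * q / real n \<le> C1 * (q * real n)"
        using C1_nonneg q(1) n mult_mono[of 1 "real n" 1 "real n"]
          mult_left_mono[of 1 "real n * real n" "C1 * q"]
        by (simp add: field_simps)
      moreover have "zeta_real \<alpha> \<le> Z * (q * real n)"
        using mult_left_mono[OF q(2), of Z] by (simp add: Z_def)
      moreover have "zeta_tail n \<alpha> \<le> q * real n / (1 - \<alpha>) + C1 * q / real n"
        using e1 q(1) by (simp add: e1_def q(3); linarith?)
      ultimately show ?thesis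
        unfolding K_def zeta_tail_def by (simp add: algebra_simps) 
    qed
    have sum_err: "\<bar>(\<Sum>k = 1..n - 1. real k powr (- \<alpha>) * (f (k - 1) - f (k + 1) + 2 * h * E 1 (real k * h)))\<bar>
        \<le> (K * (q * real n)) * (2 * B * h ^ 3)"
    proof -
      have "\<bar>(\<Sum>k = 1..n - 1. real k powr (- \<alpha>) * (f (k - 1) - f (k + 1) + 2 * h * E 1 (real k * h)))\<bar>
          \<le> (\<Sum>k = 1..n - 1. real k powr (- \<alpha>) * (2 * B * h ^ 3))"
      proof (rule order_trans[OF sum_abs sum_mono])
        fix k assume k: "k \<in> {1..n - 1}"
        have "h \<le> real k * h" "(real k + 1) * h \<le> real n * h"
          using k h n mult_right_mono[of 1 "real k" h] by (auto intro!: mult_right_mono)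
        then have "\<bar>f (k - 1) - f (k + 1) + 2 * h * E 1 (real k * h)\<bar> \<le> 2 * B * h ^ 3"
          using err(1)[of "real k * h"] k h(3) by (simp add: f_def of_nat_diff algebra_simps)
        then show "\<bar>real k powr (- \<alpha>) * (f (k - 1) - f (k + 1) + 2 * h * E 1 (real k * h))\<bar>
            \<le> real k powr (- \<alpha>) * (2 * B * h ^ 3)"
          by (simp add: abs_mult mult_left_mono)
      qed
      also have "\<dots> = (\<Sum>k = 1..n - 1. real k powr (- \<alpha>)) * (2 * B * h ^ 3)"
        by (rule sum_distrib_right[symmetric])
      also have "\<dots> \<le> (K * (q * real n)) * (2 * B * h ^ 3)"
        using B0 h by (intro mult_right_mono powr_sum) auto
      finally show ?thesis .
    qed
    define a1 where "a1 = 3 * f 0 - 4 * f 1 + f 2 + 2 * h * E 1 0"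
    define a2 where "a2 = f 0 - 2 * f 1 + f 2 - h\<^sup>2 * E 2 0"
    define a3 where "a3 = f n - f (n - 1) - h * E 1 x"
    have fn1: "f n = E 0 x" "f (n - 1) = E 0 (x - h)"
      using h(3) n by (simp_all add: f_def of_nat_diff algebra_simps)
    have a1: "\<bar>zeta_real \<alpha> * a1\<bar> \<le> Z * (12 * B * h ^ 3)"
      using err(2) unfolding abs_mult Z_def a1_def f_def by (intro mult_left_mono) auto
    have a2: "\<bar>2 * zeta_real (\<alpha> - 1) * a2\<bar> \<le> 2 * (Z1 * (10 * B * h ^ 3))"
      using err(3) mult_left_mono[of "\<bar>a2\<bar>" "10 * B * h ^ 3" Z1]
      by (simp add: abs_mult Z1_def a2_def f_def mult_ac)
    have a3: "\<bar>q * a3\<bar> \<le> q * (B * h\<^sup>2)"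
      using mult_left_mono[OF err(4) q(1)] q(1) unfolding a3_def fn1 by (simp add: abs_mult)
    have a4: "\<bar>2 * e1 * (f n - f (n - 1))\<bar> \<le> 2 * (C1 * q / real n * (B * h))"
      using e1 err(5) mult_mono[of "\<bar>e1\<bar>" "C1 * q / real n" "\<bar>f n - f (n - 1)\<bar>" "B * h"]
        C1_nonneg q(1) unfolding fn1 by (simp add: abs_mult)
    have "(\<Sum>k = 0..n. weight \<alpha> n k * f k)
      - 2 * h * ((\<Sum>k = 1..n - 1. real k powr (- \<alpha>) * (- E 1 (real k * h)))
            + q * (- E 1 x) / 2 - zeta_real \<alpha> * (- E 1 0) - zeta_real (\<alpha> - 1) * h * (- E 2 0))
      = (\<Sum>k = 1..n - 1. real k powr (- \<alpha>) * (f (k - 1) - f (k + 1) + 2 * h * E 1 (real k * h)))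
        - zeta_real \<alpha> * a1 + 2 * zeta_real (\<alpha> - 1) * a2 - q * a3 + 2 * e1 * (f n - f (n - 1))"
    proof -
      have s: "(\<Sum>k = 1..n - 1. real k powr (- \<alpha>) * (f (k - 1) - f (k + 1) + 2 * h * E 1 (real k * h)))
        = (\<Sum>k = 1..n - 1. real k powr (- \<alpha>) * (f (k - 1) - f (k + 1)))
          - 2 * h * (\<Sum>k = 1..n - 1. real k powr (- \<alpha>) * (- E 1 (real k * h)))"
        unfolding sum_distrib_left sum_subtractf[symmetric]
        by (intro sum.cong refl) (simp add: algebra_simps)
      have w: "2 * zeta_tail n \<alpha> - 2 * real n powr (1 - \<alpha>) / (1 - \<alpha>) = 2 * e1 - q"
        by (simp add: e1_def)
      show ?thesis
        unfolding weight_sum_eq[OF n] s w a1_def a2_def a3_def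
        by (simp add: algebra_simps power2_eq_square)
    qed
    then have "\<bar>(\<Sum>k = 0..n. weight \<alpha> n k * f k)
      - 2 * h * ((\<Sum>k = 1..n - 1. real k powr (- \<alpha>) * (- E 1 (real k * h)))
            + q * (- E 1 x) / 2 - zeta_real \<alpha> * (- E 1 0) - zeta_real (\<alpha> - 1) * h * (- E 2 0))\<bar>
      \<le> (K * (q * real n)) * (2 * B * h ^ 3) + (Z * (12 * B * h ^ 3) + 2 * (Z1 * (10 * B * h ^ 3)))
          + q * (B * h\<^sup>2) + 2 * (C1 * q / real n * (B * h))"
      using sum_err a1 a2 a3 a4 by linarith
    \<comment> \<open>The errors at the singular end point gain the factor \<open>q * n = n powr (1 - \<alpha>) \<ge> 1\<close>; it costs
      nothing in order and brings all terms to the form \<open>q / n\<^sup>2\<close>.\<close>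
    also have "\<dots> \<le> (K * (q * real n)) * (2 * B * h ^ 3)
          + (q * real n) * (Z * (12 * B * h ^ 3) + 2 * (Z1 * (10 * B * h ^ 3)))
          + q * (B * h\<^sup>2) + 2 * (C1 * q / real n * (B * h))"
      using mult_right_mono[OF q(2), of "Z * (12 * B * h ^ 3) + 2 * (Z1 * (10 * B * h ^ 3))"] B0 h
      by (simp add: Z_def Z1_def)
    also have "\<dots> = C * q / (real n)\<^sup>2"
      using n unfolding C_def h_def by (simp add: field_simps power2_eq_square power3_eq_cube)
    finally show "\<bar>(\<Sum>k = 0..n. weight \<alpha> n k * E 0 (real k * (x / real n)))
      - 2 * (x / real n) *
          ((\<Sum>k = 1..n - 1. real k powr (- \<alpha>) * (- E 1 (real k * (x / real n))))
            + real n powr (- \<alpha>) * (- E 1 x) / 2 - zeta_real \<alpha> * (- E 1 0)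
            - zeta_real (\<alpha> - 1) * (x / real n) * (- E 2 0))\<bar> \<le> C * real n powr (- \<alpha>) / (real n)\<^sup>2"
      unfolding h_def q_def f_def .
  qed
qed

theorem mainTheorem2:
  fixes \<alpha> x :: real and y :: "real \<Rightarrow> real"
  assumes "0 < \<alpha>" and "\<alpha> < 1" and "0 < x"
    and "smooth_on_interval 0 x y"
  shows "(\<lambda>n. caputo_approx \<alpha> y x n - caputo \<alpha> y x) \<in> O(\<lambda>n. (x / real n)\<^sup>2)"
proof -
  note \<alpha> = assms(1,2) and x = assms(3)
  obtain E B where E0: "\<And>u. u \<in> {0..x} \<Longrightarrow> y (x - u) = E 0 u"
    and dE: "\<And>j u. u \<in> {0..x} \<Longrightarrow> (E j has_real_derivative E (Suc j) u) (at u within {0..x})"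
    and B: "\<And>j u. u \<in> {0..x} \<Longrightarrow> j \<le> 3 \<Longrightarrow> \<bar>E j u\<bar> \<le> B"
    and vd: "\<And>t. t \<in> {0..x} \<Longrightarrow> vector_derivative y (at t within {0..x}) = - E 1 (x - t)"
    using smooth_reflected[OF x assms(4)] by blast
  define A where "A = (\<lambda>n. (\<Sum>k = 1..n - 1. real k powr (- \<alpha>) * (- E 1 (real k * (x / real n))))
      + real n powr (- \<alpha>) * (- E 1 x) / 2 - zeta_real \<alpha> * (- E 1 0)
      - zeta_real (\<alpha> - 1) * (x / real n) * (- E 2 0))"
  have d1: "((\<lambda>u. - E 1 u) has_real_derivative - E 2 u) (at u within {0..x})"
    and d2: "((\<lambda>u. - E 2 u) has_real_derivative - E 3 u) (at u within {0..x})"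
    and b3: "\<bar>- E 3 u\<bar> \<le> B" if "u \<in> {0..x}" for u
    using DERIV_minus[OF dE[OF that, of 1]] DERIV_minus[OF dE[OF that, of 2]] B[OF that, of 3]
    by (simp_all add: numeral_2_eq_2 numeral_3_eq_3)
  obtain I C where I: "((\<lambda>u. - E 1 u / u powr \<alpha>) has_integral I) {0..x}"
    and C: "\<And>n. 1 \<le> n \<Longrightarrow> \<bar>(x / real n) powr (1 - \<alpha>) * A n - I\<bar> \<le> C / (real n)\<^sup>2"
    using singular_trapezoid[OF \<alpha> x d1 d2 b3] unfolding A_def by blast
  obtain C' where C': "\<And>n. 5 \<le> n \<Longrightarrow>
    \<bar>(\<Sum>k = 0..n. weight \<alpha> n k * E 0 (real k * (x / real n))) - 2 * (x / real n) * A n\<bar>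
      \<le> C' * real n powr (- \<alpha>) / (real n)\<^sup>2"
    using weight_sum_error[where E = E and B = B, OF \<alpha> x dE B] unfolding A_def by blast
  have caputo: "caputo \<alpha> y x = I / Gamma (1 - \<alpha>)"
  proof -
    have "((\<lambda>t. - E 1 (x - t) / (x - t) powr \<alpha>) has_integral I) {0..x}"
      by (rule has_integral_reflect_shift[OF I])
    then have "((\<lambda>t. vector_derivative y (at t within {0..x}) / (x - t) powr \<alpha>) has_integral I) {0..x}"
      by (rule has_integral_eq[rotated]) (simp add: vd)
    then show ?thesis unfolding caputo_def by (simp add: integral_unique)
  qed
  have \<Gamma>: "Gamma (1 - \<alpha>) > 0" using \<alpha> by (intro Gamma_real_pos) auto
  define M where "M = (x powr (- \<alpha>) * C' / 2 + C) / Gamma (1 - \<alpha>)"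
  have "\<bar>caputo_approx \<alpha> y x n - caputo \<alpha> y x\<bar> \<le> M / x\<^sup>2 * \<bar>(x / real n)\<^sup>2\<bar>" if n: "5 \<le> n" for n
  proof -
    define h where "h = x / real n"
    define W where "W = (\<Sum>k = 0..n. weight \<alpha> n k * E 0 (real k * h))"
    have h: "0 < h" "real n * h = x" using n x by (auto simp: h_def)
    have "(\<Sum>k = 0..n. weight \<alpha> n k * y (real (n - k) * h)) = W"
      unfolding W_def
    proof (intro sum.cong refl)
      fix k assume k: "k \<in> {0..n}"
      then have "real k * h \<le> real n * h" using h by (intro mult_right_mono) auto
      moreover have "real (n - k) * h = x - real k * h"
        using k h(2) by (simp add: of_nat_diff algebra_simps)
      ultimately show "weight \<alpha> n k * y (real (n - k) * h) = weight \<alpha> n k * E 0 (real k * h)"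
        using E0[of "real k * h"] h by simp
    qed
    then have approx: "caputo_approx \<alpha> y x n = h powr (- \<alpha>) * W / 2 / Gamma (1 - \<alpha>)"
      unfolding caputo_approx_def Let_def h_def[symmetric] by (simp add: powr_minus_divide)
    have "h powr (1 - \<alpha>) = h powr (- \<alpha>) * h"
      using powr_add[of h "- \<alpha>" 1] h by simp
    \<comment> \<open>The first summand is the error of the difference quotients, the second that of the
      quadrature.\<close>
    then have split: "h powr (- \<alpha>) * W / 2 - I
        = h powr (- \<alpha>) * (W - 2 * h * A n) / 2 + (h powr (1 - \<alpha>) * A n - I)"
      by (simp add: algebra_simps diff_divide_distrib)
    have "\<bar>h powr (- \<alpha>) * (W - 2 * h * A n) / 2\<bar> \<le> h powr (- \<alpha>) * (C' * real n powr (- \<alpha>) / (real n)\<^sup>2) / 2"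
      using mult_left_mono[OF C'[OF n, folded h_def, folded W_def], of "h powr (- \<alpha>)"] by (simp add: abs_mult)
    also have "\<dots> = x powr (- \<alpha>) * C' / 2 / (real n)\<^sup>2"
      using powr_mult[of "real n" h "- \<alpha>"] h by (simp add: mult_ac)
    finally have "\<bar>h powr (- \<alpha>) * W / 2 - I\<bar> \<le> x powr (- \<alpha>) * C' / 2 / (real n)\<^sup>2 + C / (real n)\<^sup>2"
      using C[of n] n unfolding split h_def[symmetric] by linarith
    from divide_right_mono[OF this, of "Gamma (1 - \<alpha>)"]
    have "\<bar>h powr (- \<alpha>) * W / 2 - I\<bar> / Gamma (1 - \<alpha>) \<le> M / (real n)\<^sup>2"
      using \<Gamma> by (simp add: M_def add_divide_distrib mult_ac)
    moreover have "\<bar>caputo_approx \<alpha> y x n - caputo \<alpha> y x\<bar> = \<bar>h powr (- \<alpha>) * W / 2 - I\<bar> / Gamma (1 - \<alpha>)"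
      unfolding approx caputo diff_divide_distrib[symmetric] using \<Gamma> by (simp only: abs_divide abs_of_pos)
    ultimately show ?thesis using x by (simp add: power_divide)
  qed
  then show ?thesis
    by (intro bigoI[of _ "M / x\<^sup>2"] eventually_sequentiallyI[of 5]) simp
qed

end
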